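(* In the two-dimensional setting of the context, let $u$ satisfy the corner expansion $$u(r,\theta)=\Lambda\,r^\lambda\,\Phi(\theta)+w,\qquad w\in(H^{1+\lambda+\varepsilon})^2\ \text{locally near }x_0,\ \varepsilon>0,$$ with $\Lambda\ne0$ and a real exponent $\lambda\notin\mathbb N$, $0<\lambda<p$, and suppose that the junction $x_0$ lies in the interior of a cell $K^*\in T^h_\Omega$ with $\operatorname{dist}(x_0,\partial K^* )\ge\rho h$ for some fixed $\rho>0$. Then there exist $c>0$ and $h_1>0$, independent of $h$ and of the discrete solution, such that for all $h\le h_1$, $$\|u-u_h\|_{L^2(\Omega)}\ \ge\ c\,|\Lambda|\,h^{1+\lambda}\qquad\text{for every }u_h\in\mathbb V_h .$$
   Context: $d=2$. $\Omega\subset\mathbb R^2$ is a bounded domain and $x_0\in\partial\Omega$ is a junction point at which two straight boundary segments meet, so that near $x_0$ the domain $\Omega$ coincides with a sector (cone) of interior opening angle $\omega$; $(r,\theta)$ are polar coordinates centred at $x_0$. $\Phi(\theta)$ is the (smooth, nonzero) vector-valued angular eigenfunction associated with the singular exponent $\lambda$ of the corner, and $\Lambda$ is the stress-intensity factor. $u$ is the exact displacement, $u\in(H^1(\Omega))^2$. $\{\mathcal T^h\}$ is a family of quasi-uniform Cartesian background meshes, $h=\max_T\operatorname{diam}T$, $T^h_\Omega=\{T\in\mathcal T^h:T\cap\Omega\ne\emptyset\}$, $\Omega_T=\bigcup_{T\in T^h_\Omega}T$, and, for $p\ge1$, $\mathbb V_h=\{v\in[C^0(\Omega_T)]^2:v|_T\in[\mathcal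 Q_p(T)]^2\ \forall T\in T^h_\Omega\}$, where $\mathcal Q_p(T)$ is the space of polynomials of degree at most $p$ in each coordinate. The constant $\rho$ is the same for all meshes in the family (the cell $K^*$ may depend on $h$). *)

theory Defs
  imports "HOL-Analysis.Analysis"
begin

subsection \<open>Square-integrable functions\<close>

definition L2_on :: "'a::euclidean_space set \<Rightarrow> ('a \<Rightarrow> 'b::euclidean_space) \<Rightarrow> bool" where
  "L2_on S f \<longleftrightarrow>
     set_borel_measurable lebesgue S f \<and> set_integrable lebesgue S (\<lambda>x. (norm (f x))\<^sup>2)"

definition L2_norm_on :: "'a::euclidean_space set \<Rightarrow> ('a \<Rightarrow> 'b::euclidean_space) \<Rightarrow> real" where
  "L2_norm_on S f = sqrt (LINT x:S|lebesgue. (norm (f x))\<^sup>2)"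


subsection \<open>Weak derivatives and Sobolev(-Slobodeckij) spaces\<close>

definition partial :: "'n::finite \<Rightarrow> (real ^ 'n \<Rightarrow> real) \<Rightarrow> real ^ 'n \<Rightarrow> real" where
  "partial i f x = frechet_derivative f (at x) (axis i 1)"

text \<open>Multi-indices are lists of coordinate directions; the order of the derivative is the
  length of the list.\<close>

primrec partials :: "'n::finite list \<Rightarrow> (real ^ 'n \<Rightarrow> real) \<Rightarrow> real ^ 'n \<Rightarrow> real" where
  "partials [] f = f"
| "partials (i # is) f = partial i (partials is f)"

definition test_function :: "(real ^ 'n::finite) set \<Rightarrow> (real ^ 'n \<Rightarrow> real) \<Rightarrow> bool" where
  "test_function S \<phi> \<longleftrightarrow>
     (\<forall>is x. partials is \<phi> differentiable (at x)) \<and>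
     (\<exists>K. compact K \<and> K \<subseteq> S \<and> (\<forall>x. x \<notin> K \<longrightarrow> \<phi> x = 0))"

text \<open>Only used for square-integrable \<open>f\<close> and \<open>g\<close>, so that both integrals exist.\<close>

definition weak_partials ::
    "(real ^ 'n::finite) set \<Rightarrow> 'n list \<Rightarrow> (real ^ 'n \<Rightarrow> real) \<Rightarrow> (real ^ 'n \<Rightarrow> real) \<Rightarrow> bool" where
  "weak_partials S is f g \<longleftrightarrow>
     (\<forall>\<phi>. test_function S \<phi> \<longrightarrow>
        (LINT x:S|lebesgue. f x * partials is \<phi> x) =
        (- 1) ^ length is * (LINT x:S|lebesgue. g x * \<phi> x))"

text \<open>Finiteness of the Gagliardo seminorm of order \<open>\<sigma>\<close> with \<open>0 < \<sigma> < 1\<close>.\<close>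

definition finite_gagliardo ::
    "real \<Rightarrow> (real ^ 'n::finite) set \<Rightarrow> (real ^ 'n \<Rightarrow> real) \<Rightarrow> bool" where
  "finite_gagliardo \<sigma> S g \<longleftrightarrow>
     (\<integral>\<^sup>+x\<in>S. (\<integral>\<^sup>+y\<in>S.
        ennreal ((g x - g y)\<^sup>2 / norm (x - y) powr (real CARD('n) + 2 * \<sigma>))
      \<partial>lebesgue) \<partial>lebesgue) < \<infinity>"

text \<open>The space \<open>H\<^sup>s(S)\<close> for real \<open>s \<ge> 0\<close> and open \<open>S\<close>: all weak derivatives of order at most
  \<open>\<lfloor>s\<rfloor>\<close> lie in \<open>L\<^sup>2(S)\<close>, and if \<open>s\<close> is not an integer, those of order \<open>\<lfloor>s\<rfloor>\<close> have a finite
  Gagliardo seminorm of order \<open>s - \<lfloor>s\<rfloor>\<close>.\<close>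

definition sobolev_H :: "real \<Rightarrow> (real ^ 'n::finite) set \<Rightarrow> (real ^ 'n \<Rightarrow> real) \<Rightarrow> bool" where
  "sobolev_H s S f \<longleftrightarrow>
     L2_on S f \<and>
     (\<forall>is. length is \<le> nat \<lfloor>s\<rfloor> \<longrightarrow>
        (\<exists>g. L2_on S g \<and> weak_partials S is f g \<and>
             (length is = nat \<lfloor>s\<rfloor> \<and> frac s > 0 \<longrightarrow> finite_gagliardo (frac s) S g)))"

definition sobolev_H_vec ::
    "real \<Rightarrow> (real ^ 'n::finite) set \<Rightarrow> (real ^ 'n \<Rightarrow> real ^ 'm::finite) \<Rightarrow> bool" where
  "sobolev_H_vec s S f \<longleftrightarrow> (\<forall>k. sobolev_H s S (\<lambda>x. f x $ k))"


subsection \<open>Corners\<close>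

definition polar :: "real ^ 2 \<Rightarrow> real \<Rightarrow> real \<Rightarrow> real ^ 2" where
  "polar x0 r \<theta> = x0 + r *\<^sub>R vector [cos \<theta>, sin \<theta>]"

text \<open>The infinite open sector with apex \<open>x0\<close> and opening angle \<open>\<omega>\<close>, whose first edge has
  direction angle \<open>\<alpha>\<close>. The angle \<open>\<alpha>\<close> matters because the meshes below are axis-parallel.\<close>

definition sector :: "real ^ 2 \<Rightarrow> real \<Rightarrow> real \<Rightarrow> (real ^ 2) set" where
  "sector x0 \<alpha> \<omega> = {polar x0 r \<theta> | r \<theta>. 0 < r \<and> \<alpha> < \<theta> \<and> \<theta> < \<alpha> + \<omega>}"

text \<open>\<open>C\<^sup>\<infinity>\<close>-smoothness on an open interval, with \<open>D k\<close> the \<open>k\<close>-th derivative.\<close>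

definition smooth_curve_on :: "real set \<Rightarrow> (real \<Rightarrow> 'a::real_normed_vector) \<Rightarrow> bool" where
  "smooth_curve_on I f \<longleftrightarrow>
     (\<exists>D. D 0 = f \<and>
          (\<forall>k. \<forall>t\<in>I. (D k has_vector_derivative D (Suc k) t) (at t)))"


subsection \<open>Cartesian meshes and the finite element space\<close>

definition cartesian_mesh :: "(real ^ 2) set set \<Rightarrow> bool" where
  "cartesian_mesh \<T> \<longleftrightarrow>
     (\<exists>m n (xs :: nat \<Rightarrow> real) (ys :: nat \<Rightarrow> real).
        0 < m \<and> 0 < n \<and> strict_mono_on {..m} xs \<and> strict_mono_on {..n} ys \<and>
        \<T> = {cbox (vector [xs i, ys j]) (vector [xs (Suc i), ys (Suc j)]) | i j. i < m \<and> j < n})"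

definition mesh_size :: "(real ^ 2) set set \<Rightarrow> real" where
  "mesh_size \<T> = Max (diameter ` \<T>)"

text \<open>A family of meshes is quasi-uniform if, with one constant \<open>\<kappa>\<close> for all its members, every
  cell contains a ball of radius \<open>\<kappa>\<close> times the mesh size.\<close>

definition quasi_uniform_family :: "(real ^ 2) set set set \<Rightarrow> bool" where
  "quasi_uniform_family \<F> \<longleftrightarrow>
     (\<exists>\<kappa>>0. \<forall>\<T>\<in>\<F>. \<forall>T\<in>\<T>. \<exists>y. ball y (\<kappa> * mesh_size \<T>) \<subseteq> T)"

definition active_cells :: "(real ^ 2) set \<Rightarrow> (real ^ 2) set set \<Rightarrow> (real ^ 2) set set" where
  "active_cells \<Omega> \<T> = {T \<in> \<T>. T \<inter> \<Omega> \<noteq> {}}"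

definition Q_poly_on :: "nat \<Rightarrow> (real ^ 2) set \<Rightarrow> (real ^ 2 \<Rightarrow> real) \<Rightarrow> bool" where
  "Q_poly_on p T v \<longleftrightarrow>
     (\<exists>c :: nat \<Rightarrow> nat \<Rightarrow> real. \<forall>x\<in>T. v x = (\<Sum>i\<le>p. \<Sum>j\<le>p. c i j * (x $ 1) ^ i * (x $ 2) ^ j))"

definition fe_space ::
    "nat \<Rightarrow> (real ^ 2) set \<Rightarrow> (real ^ 2) set set \<Rightarrow> (real ^ 2 \<Rightarrow> real ^ 2) set" where
  "fe_space p \<Omega> \<T> =
     {v. continuous_on (\<Union>(active_cells \<Omega> \<T>)) v \<and>
         (\<forall>T\<in>active_cells \<Omega> \<T>. \<forall>k. Q_poly_on p T (\<lambda>x. v x $ k))}"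

end

theory Submission
  imports Defs
begin

text \<open>
  The bound follows by duality. Fix a product test function
  \<open>\<phi> y = a\<^bsup>(M)\<^esup> (y\<^sub>i) * b (y\<^sub>j)\<close> supported in a small box inside the sector and in the ball of
  radius \<open>\<rho>\<close>, and rescale it by \<open>h\<close> around \<open>x0\<close>. If \<open>M > p\<close> the rescaled function annihilates
  \<open>u_h\<close>, which is a single polynomial on the cell containing \<open>x0\<close>. By homogeneity its pairing with
  \<open>\<Lambda> r\<^sup>\<lambda> \<Phi>\<close> is \<open>\<Lambda> h\<close> to the power \<open>2 + \<lambda>\<close> times a fixed integral. With \<open>m\<close> the integer part of
  \<open>1 + \<lambda> + \<epsilon>\<close>, moving \<open>m\<close> derivatives onto \<open>w\<close> and using that the remaining factor has mean zero
  gives a pairing with \<open>w\<close> of order \<open>2 + \<lambda> + \<epsilon>\<close>, which is negligible. Since \<open>\<phi>\<close> has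
  \<open>L\<^sup>2\<close> norm of order \<open>h\<close> after rescaling, the bound follows.

  The fixed integral can be made nonzero because \<open>\<lambda>\<close> is not a natural number: along a ray where
  \<open>\<Phi>\<close> does not vanish, no finite difference of \<open>r\<^sup>\<lambda>\<close> vanishes. A high-order difference of a bump in
  that direction splits by the Leibniz rule into products in which one factor is
  differenced at least \<open>M\<close> times, and a difference of a bump is the derivative of another bump.
\<close>

subsection \<open>Smooth functions of compact support\<close>

text \<open>All derivatives are carried along as one sequence, so that differentiating is a shift of
  the index, and products, translations and rescalings are again explicit sequences.\<close>

definition smooth_family :: "(nat \<Rightarrow> real \<Rightarrow> real) \<Rightarrow> bool" where
  "smooth_family D \<longleftrightarrow> (\<forall>k t. (D k has_real_derivative D (Suc k) t) (at t))"

lemma smooth_familyD: "smooth_family D \<Longrightarrow> (D k has_real_derivative D (Suc k) t) (at t)"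
  by (simp add: smooth_family_def)

lemma smooth_family_continuous: "smooth_family D \<Longrightarrow> continuous_on A (D k)"
  by (meson DERIV_isCont continuous_at_imp_continuous_on smooth_familyD)

lemma smooth_family_shift: "smooth_family D \<Longrightarrow> smooth_family (\<lambda>k. D (n + k))"
  by (simp add: smooth_family_def)

lemma smooth_family_translate:
  assumes "smooth_family D"
  shows "smooth_family (\<lambda>k t. D k (t + s))"
  using assms DERIV_shift unfolding smooth_family_def by blast

text \<open>The sign of \<open>h\<close> is left free: \<open>h = - 1\<close> reflects, which
  supplies the right half of the bump in \<open>smooth_bump\<close>, and a positive \<open>h\<close>
  shrinks the test function to the mesh size.\<close>

lemma smooth_family_rescale:
  assumes "smooth_family D"
  shows "smooth_family (\<lambda>k t. (1 / h) ^ k * D k ((t - c) / h))"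
  unfolding smooth_family_def
proof (intro allI)
  fix k :: nat and t :: real
  have "((\<lambda>t. (t - c) / h) has_real_derivative 1 / h) (at t)"
    by (cases "h = 0") (auto intro!: derivative_eq_intros)
  from DERIV_cmult[OF DERIV_chain'[OF this smooth_familyD[OF assms, of k]], of "(1 / h) ^ k"]
  show "((\<lambda>t. (1 / h) ^ k * D k ((t - c) / h)) has_real_derivative
      (1 / h) ^ Suc k * D (Suc k) ((t - c) / h)) (at t)"
    by (simp add: mult_ac)
qed

text \<open>The complement of a closed interval is open, so a member that vanishes there vanishes in
  a neighbourhood of each of its points, and its derivative is zero there.\<close>

lemma smooth_family_support:
  assumes D: "smooth_family D" and supp: "\<And>t. r < \<bar>t - c\<bar> \<Longrightarrow> D 0 t = 0"
  shows "r < \<bar>t - c\<bar> \<Longrightarrow> D k t = 0"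
proof (induction k arbitrary: t)
  case 0
  then show ?case using supp by simp
next
  case (Suc k)
  have "open {t. r < \<bar>t - c\<bar>}"
    by (intro open_Collect_less continuous_intros)
  then have "\<forall>\<^sub>F y in nhds t. y \<in> {t. r < \<bar>t - c\<bar>}"
    using Suc.prems by (intro eventually_nhds_in_open) auto
  then have "\<forall>\<^sub>F y in nhds t. D k y = 0"
    by (rule eventually_mono) (use Suc.IH in auto)
  then have "((\<lambda>_. 0) has_real_derivative D (Suc k) t) (at t)"
    using smooth_familyD[OF D, of k t] DERIV_cong_ev[of t t "D k" "\<lambda>_. 0"] by auto
  then show ?case
    using DERIV_unique[OF DERIV_const] by metis
qed

lemma smooth_family_mult:
  assumes D: "smooth_family D" and G: "smooth_family G"
  shows "smooth_family (\<lambda>k t. \<Sum>i\<le>k. real (k choose i) * D i t * G (k - i) t)"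
  unfolding smooth_family_def
proof (intro allI)
  fix k :: nat and t :: real
  have deriv: "((\<lambda>t. \<Sum>i\<le>k. real (k choose i) * D i t * G (k - i) t) has_real_derivative
      (\<Sum>i\<le>k. real (k choose i) * (D (Suc i) t * G (k - i) t + D i t * G (Suc (k - i)) t))) (at t)"
  proof (rule DERIV_sum)
    fix i
    show "((\<lambda>t. real (k choose i) * D i t * G (k - i) t) has_real_derivative
        real (k choose i) * (D (Suc i) t * G (k - i) t + D i t * G (Suc (k - i)) t)) (at t)"
      using DERIV_mult[OF DERIV_cmult[OF smooth_familyD[OF D, of i t], of "real (k choose i)"] smooth_familyD[OF G, of "k - i" t]]
      by (simp add: algebra_simps)
  qed
  have "(\<Sum>i\<le>k. real (k choose i) * (D (Suc i) t * G (k - i) t + D i t * G (Suc (k - i)) t))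
      = (\<Sum>i\<le>k. real (k choose i) * (D (Suc i) t * G (k - i) t)) + (\<Sum>i\<le>k. real (k choose i) * (D i t * G (Suc k - i) t))"
    by (simp add: sum.distrib algebra_simps Suc_diff_le)
  \<comment> \<open>\<open>k choose Suc k\<close> is zero, so the range may be extended by one;
    shifting the index then lets Pascal's rule merge the two sums.\<close>
  also have "(\<Sum>i\<le>k. real (k choose i) * (D i t * G (Suc k - i) t))
     = (\<Sum>i\<le>Suc k. real (k choose i) * (D i t * G (Suc k - i) t))"
    by simp
  also have "\<dots> = D 0 t * G (Suc k) t + (\<Sum>i\<le>k. real (k choose Suc i) * (D (Suc i) t * G (k - i) t))"
    by (subst sum.atMost_Suc_shift) simp
  finally have "(\<Sum>i\<le>k. real (k choose i) * (D (Suc i) t * G (k - i) t + D i t * G (Suc (k - i)) t))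
     = (\<Sum>i\<le>Suc k. real (Suc k choose i) * D i t * G (Suc k - i) t)"
    by (subst sum.atMost_Suc_shift) (simp add: sum.distrib algebra_simps)
  with deriv show "((\<lambda>t. \<Sum>i\<le>k. real (k choose i) * D i t * G (k - i) t) has_real_derivative
       (\<Sum>i\<le>Suc k. real (Suc k choose i) * D i t * G (Suc k - i) t)) (at t)"
    by simp
qed

text \<open>The \<open>k\<close>-th derivative of \<open>exp (- 1 / t)\<close> is \<open>P (1 / t) * exp (- 1 / t)\<close> with \<open>P\<close> the
  following polynomial.\<close>

primrec exp_inv_poly :: "nat \<Rightarrow> real poly" where
  "exp_inv_poly 0 = 1"
| "exp_inv_poly (Suc k) = [:0, 0, 1:] * (exp_inv_poly k - pderiv (exp_inv_poly k))"

definition exp_inv :: "nat \<Rightarrow> real \<Rightarrow> real" where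
  "exp_inv k t = (if t \<le> 0 then 0 else poly (exp_inv_poly k) (1 / t) * exp (- (1 / t)))"

lemma poly_times_exp_minus_tendsto_0:
  "((\<lambda>s. poly q s * exp (- s)) \<longlongrightarrow> (0::real)) at_top"
proof -
  have "((\<lambda>s. \<Sum>i\<le>degree q. coeff q i * (s ^ i / exp s)) \<longlongrightarrow> (\<Sum>i\<le>degree q. coeff q i * 0)) at_top"
    by (intro tendsto_intros tendsto_power_div_exp_0)
  then show ?thesis
    by (simp add: poly_altdef sum_divide_distrib exp_minus divide_inverse sum_distrib_right mult.assoc)
qed

text \<open>Away from zero this is the chain rule. At zero the difference quotient from the right is
  a polynomial in \<open>1 / y\<close> times \<open>exp (- 1 / y)\<close>, which tends to zero
  because the exponential beats every polynomial.\<close>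

lemma smooth_family_exp_inv: "smooth_family exp_inv"
  unfolding smooth_family_def
proof (intro allI)
  fix k :: nat and t :: real
  consider "t < 0" | "t > 0" | "t = 0" by linarith
  then show "(exp_inv k has_real_derivative exp_inv (Suc k) t) (at t)"
  proof cases
    case 1
    then have ev: "\<forall>\<^sub>F y in nhds t. exp_inv k y = 0"
      using eventually_nhds_in_open[of "{..<0}" t] by (auto simp: exp_inv_def elim!: eventually_mono)
    from 1 have "exp_inv (Suc k) t = 0" by (simp add: exp_inv_def)
    then show ?thesis
      using DERIV_cong_ev[OF refl ev refl] by simp
  next
    case 2
    then have ev: "\<forall>\<^sub>F y in nhds t. exp_inv k y = poly (exp_inv_poly k) (1 / y) * exp (- (1 / y))"
      using eventually_nhds_in_open[of "{0<..}" t] by (auto simp: exp_inv_def elim!: eventually_mono)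
    have inv: "((\<lambda>y. 1 / y) has_real_derivative - (1 / t\<^sup>2)) (at t)"
      using 2 by (auto intro!: derivative_eq_intros simp: power2_eq_square)
    have "((\<lambda>y. poly (exp_inv_poly k) (1 / y) * exp (- (1 / y))) has_real_derivative
        poly (pderiv (exp_inv_poly k)) (1 / t) * - (1 / t\<^sup>2) * exp (- (1 / t))
        + exp (- (1 / t)) * - (- (1 / t\<^sup>2)) * poly (exp_inv_poly k) (1 / t)) (at t)"
      by (rule DERIV_mult[OF DERIV_chain'[OF inv poly_DERIV] DERIV_chain'[OF DERIV_minus[OF inv] DERIV_exp]])
    also have "poly (pderiv (exp_inv_poly k)) (1 / t) * - (1 / t\<^sup>2) * exp (- (1 / t))
        + exp (- (1 / t)) * - (- (1 / t\<^sup>2)) * poly (exp_inv_poly k) (1 / t) = exp_inv (Suc k) t"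
      using 2 by (simp add: exp_inv_def power2_eq_square algebra_simps)
    finally have "((\<lambda>y. poly (exp_inv_poly k) (1 / y) * exp (- (1 / y))) has_real_derivative exp_inv (Suc k) t) (at t)" .
    then show ?thesis
      using DERIV_cong_ev[OF refl ev refl] by simp
  next
    case 3
    have pos: "((\<lambda>y. (exp_inv k y - exp_inv k 0) / (y - 0)) \<longlongrightarrow> 0) (at_right 0)"
    proof (rule Lim_transform_eventually)
      \<comment> \<open>The factor \<open>[:0, 1:]\<close> is the extra \<open>1 / y\<close> of the
        difference quotient.\<close>
      show "((\<lambda>y. poly ([:0, 1:] * exp_inv_poly k) (inverse y) * exp (- (inverse y))) \<longlongrightarrow> 0) (at_right (0::real))"
        by (rule filterlim_compose[OF poly_times_exp_minus_tendsto_0 filterlim_inverse_at_top_right])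
      show "\<forall>\<^sub>F y in at_right 0. poly ([:0, 1:] * exp_inv_poly k) (inverse y) * exp (- (inverse y))
            = (exp_inv k y - exp_inv k 0) / (y - 0)"
        using eventually_at_right_less[of "0::real"]
        by eventually_elim (auto simp: exp_inv_def field_simps)
    qed
    have neg: "((\<lambda>y. (exp_inv k y - exp_inv k 0) / (y - 0)) \<longlongrightarrow> 0) (at_left 0)"
      by (rule Lim_transform_eventually[OF tendsto_const])
         (auto simp: exp_inv_def eventually_at_filter)
    have "((\<lambda>y. (exp_inv k y - exp_inv k 0) / (y - 0)) \<longlongrightarrow> 0) (at 0)"
      using pos neg filterlim_split_at by blast
    then show ?thesis
      using 3 by (simp add: has_field_derivative_iff exp_inv_def)
  qed
qed

text \<open>A product of two flat one-sided functions, one vanishing up to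
  \<open>c - \<delta>\<close> and one from \<open>c + \<delta>\<close> on.\<close>

lemma smooth_bump:
  fixes c \<delta> :: real
  assumes "\<delta> > 0"
  obtains D where "smooth_family D" "\<And>t. D 0 t \<ge> 0" "\<And>t. \<delta> < \<bar>t - c\<bar> \<Longrightarrow> D 0 t = 0" "D 0 c > 0"
proof -
  define G1 where "G1 = (\<lambda>k t. (1 / 1) ^ k * exp_inv k ((t - (c - \<delta>)) / 1))"
  define G2 where "G2 = (\<lambda>k t. (1 / (- 1)) ^ k * exp_inv k ((t - (c + \<delta>)) / (- 1)))"
  define D where "D = (\<lambda>k t. \<Sum>i\<le>k. (k choose i) * G1 i t * G2 (k - i) t)"
  have "smooth_family G1" "smooth_family G2"
    unfolding G1_def G2_def by (intro smooth_family_rescale smooth_family_exp_inv)+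
  then have "smooth_family D"
    unfolding D_def by (rule smooth_family_mult[of G1 G2])
  moreover have "D 0 t = exp_inv 0 (t - (c - \<delta>)) * exp_inv 0 (c + \<delta> - t)" for t
    by (simp add: D_def G1_def G2_def algebra_simps)
  ultimately show ?thesis
    using assms by (intro that[of D]) (auto simp: exp_inv_def)
qed

text \<open>The order \<open>n\<close> stands for the number of vanishing moments of
  \<open>f\<close>, the radius \<open>r\<close> bounds the support of the underlying bump.
  Differencing raises the first by one and enlarges the second by the step.\<close>

definition bump_deriv :: "nat \<Rightarrow> real \<Rightarrow> real \<Rightarrow> (real \<Rightarrow> real) \<Rightarrow> bool" where
  "bump_deriv n c r f \<longleftrightarrow>
     (\<exists>D. smooth_family D \<and> (\<forall>t. r < \<bar>t - c\<bar> \<longrightarrow> D 0 t = 0) \<and> D n = f)"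

lemma bump_deriv_translate:
  assumes "bump_deriv n c r f" "r + \<bar>s\<bar> \<le> r'"
  shows "bump_deriv n c r' (\<lambda>t. f (t + s))"
proof -
  obtain D where D: "smooth_family D" "\<And>t. r < \<bar>t - c\<bar> \<Longrightarrow> D 0 t = 0" "D n = f"
    using assms(1) by (auto simp: bump_deriv_def)
  show ?thesis
    unfolding bump_deriv_def
    by (rule exI[of _ "\<lambda>k t. D k (t + s)"])
       (use D assms(2) in \<open>auto simp: smooth_family_translate intro!: D(2)\<close>)
qed

text \<open>A difference \<open>D 0 (t + s) - D 0 t\<close> is the derivative of the compactly supported
  \<open>\<integral> D 0\<close> over \<open>[t, t + s]\<close>.\<close>

lemma bump_deriv_difference:
  assumes "bump_deriv n c r f" "r + \<bar>s\<bar> \<le> r'"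
  shows "bump_deriv (Suc n) c r' (\<lambda>t. f (t + s) - f t)"
proof -
  obtain D where D: "smooth_family D" "\<And>t. r < \<bar>t - c\<bar> \<Longrightarrow> D 0 t = 0" "D n = f"
    using assms(1) by (auto simp: bump_deriv_def)
  have "isCont (D 0) t" for t
    using smooth_familyD[OF D(1)] DERIV_isCont by blast
  then obtain H where H: "\<And>t. (H has_real_derivative D 0 t) (at t)"
    using einterval_antiderivative[of "-\<infinity>" "\<infinity>" "D 0"]
    by (auto simp: has_real_derivative_iff_has_vector_derivative[symmetric])
  \<comment> \<open>\<open>H\<close> is constant on each side of the support, possibly with
    different constants on the two sides.\<close>
  have const: "H x = H y" if "x \<le> y" "\<And>t. t \<in> {x<..<y} \<Longrightarrow> r < \<bar>t - c\<bar>" for x y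
  proof (cases "x = y")
    case False
    then have "x < y" using that by simp
    moreover have "continuous_on {x..y} H"
      using H DERIV_isCont continuous_at_imp_continuous_on by blast
    moreover have "(H has_real_derivative 0) (at t)" if "x < t" "t < y" for t
      using H[of t] D(2)[of t] \<open>\<And>t. t \<in> {x<..<y} \<Longrightarrow> r < \<bar>t - c\<bar>\<close>[of t] that by simp
    ultimately show ?thesis
      using DERIV_isconst_end[of x y H] by simp
  qed simp
  define A where "A = (\<lambda>k t. case k of 0 \<Rightarrow> H (t + s) - H t | Suc k \<Rightarrow> D k (t + s) - D k t)"
  have "(A k has_real_derivative A (Suc k) t) (at t)" for k t
  proof (cases k)
    case 0
    have "((\<lambda>t. H (t + s)) has_real_derivative D 0 (t + s)) (at t)"
      using H DERIV_shift by blast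
    then show ?thesis
      using DERIV_diff[OF _ H[of t]] 0 by (simp add: A_def)
  next
    case (Suc j)
    have "((\<lambda>t. D j (t + s)) has_real_derivative D k (t + s)) (at t)"
      using smooth_familyD[OF smooth_family_translate[OF D(1), of s], of j t] Suc by simp
    then show ?thesis
      using DERIV_diff[OF _ smooth_familyD[OF D(1), of j t]] Suc by (simp add: A_def)
  qed
  \<comment> \<open>The margin \<open>r' \<ge> r + \<bar>s\<bar>\<close> keeps \<open>t\<close> and
    \<open>t + s\<close> on the same side of the support, so the constants cancel.\<close>
  moreover have "A 0 t = 0" if t: "r' < \<bar>t - c\<bar>" for t
  proof -
    have "H (t + s) = H t"
    proof (cases "s \<ge> 0")
      case True
      then show ?thesis
        using const[of t "t + s"] t assms(2) by force
    next
      case False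
      then show ?thesis
        using const[of "t + s" t] t assms(2) by force
    qed
    then show ?thesis by (simp add: A_def)
  qed
  ultimately show ?thesis
    unfolding bump_deriv_def smooth_family_def
    using D(3) by (intro exI[of _ A] conjI) (simp_all add: A_def fun_eq_iff)
qed

subsection \<open>Products of functions of the two coordinates\<close>

lemma UNIV_2_eq:
  fixes i j :: 2
  assumes "i \<noteq> j"
  shows "UNIV = {i, j}"
  using assms exhaust_2[of i] exhaust_2[of j] by (auto simp: UNIV_2)

text \<open>A Borel measure that gives boxes their volume is \<open>lborel\<close>, and the preimage
  of a box is a product of two intervals. Either coordinate may play the first role, which spares a
  case distinction in later integrals.\<close>

lemma lborel_real2_eq_distr:
  fixes i j :: 2
  assumes ij: "i \<noteq> j"
  shows "(lborel :: (real ^ 2) measure) =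
    distr (lborel \<Otimes>\<^sub>M lborel) borel (\<lambda>z. \<chi> k. if k = i then fst z else snd z)"
    (is "_ = distr _ _ ?T")
proof (rule lborel_eqI)
  have cont: "continuous_on UNIV ?T"
  proof (rule continuous_on_vec_lambda)
    fix k :: 2
    show "continuous_on UNIV (\<lambda>z::real \<times> real. if k = i then fst z else snd z)"
      by (cases "k = i") (auto intro!: continuous_intros)
  qed
  have meas: "?T \<in> (lborel \<Otimes>\<^sub>M lborel) \<rightarrow>\<^sub>M borel"
    using borel_measurable_continuous_onI[OF cont] by (simp add: borel_prod[symmetric] cong: measurable_cong_sets)
  fix l u :: "real ^ 2"
  assume le: "\<And>b. b \<in> Basis \<Longrightarrow> l \<bullet> b \<le> u \<bullet> b"
  have Basis: "(Basis :: (real ^ 2) set) = {axis i 1, axis j 1}"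
    by (auto simp: Basis_vec_def UNIV_2_eq[OF ij])
  have ne: "axis i 1 \<noteq> (axis j 1 :: real ^ 2)"
    using ij by (simp add: axis_eq_axis)
  have vim: "?T -` box l u = {l $ i <..< u $ i} \<times> {l $ j <..< u $ j}"
    using ij by (auto simp: mem_box Basis inner_axis)
  have "emeasure (distr (lborel \<Otimes>\<^sub>M lborel) borel ?T) (box l u)
      = emeasure (lborel \<Otimes>\<^sub>M lborel) ({l $ i <..< u $ i} \<times> {l $ j <..< u $ j})"
    by (subst emeasure_distr[OF meas]) (auto simp: vim space_pair_measure)
  also have "\<dots> = emeasure lborel {l $ i <..< u $ i} * emeasure lborel {l $ j <..< u $ j}"
    by (intro lborel.emeasure_pair_measure_Times) auto
  also have "\<dots> = ennreal (\<Prod>b\<in>Basis. (u - l) \<bullet> b)"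
    using le[of "axis i 1"] le[of "axis j 1"] ne
    by (simp add: Basis inner_axis ennreal_mult'')
  finally show "emeasure (distr (lborel \<Otimes>\<^sub>M lborel) borel ?T) (box l u)
      = ennreal (\<Prod>b\<in>Basis. (u - l) \<bullet> b)" .
qed simp

lemma integral_tensor:
  fixes i j :: 2 and f g :: "real \<Rightarrow> real"
  assumes ij: "i \<noteq> j" and f: "integrable lborel f" and g: "integrable lborel g"
  shows "(LINT x::real^2|lborel. f (x $ i) * g (x $ j)) = integral\<^sup>L lborel f * integral\<^sup>L lborel g"
    and "integrable lborel (\<lambda>x::real^2. f (x $ i) * g (x $ j))"
proof -
  let ?T = "\<lambda>z. (\<chi> k. if k = i then fst z else snd z) :: real ^ 2"
  have [measurable]: "f \<in> borel_measurable borel" "g \<in> borel_measurable borel"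
    using f g by auto
  have cont: "continuous_on UNIV ?T"
  proof (rule continuous_on_vec_lambda)
    fix k :: 2
    show "continuous_on UNIV (\<lambda>z::real \<times> real. if k = i then fst z else snd z)"
      by (cases "k = i") (auto intro!: continuous_intros)
  qed
  have T: "?T \<in> (lborel \<Otimes>\<^sub>M lborel) \<rightarrow>\<^sub>M borel"
    using borel_measurable_continuous_onI[OF cont] by (simp add: borel_prod[symmetric] cong: measurable_cong_sets)
  have comp: "(\<lambda>x::real^2. f (x $ i) * g (x $ j)) \<in> borel_measurable borel"
    by measurable
  have int: "integrable (lborel \<Otimes>\<^sub>M lborel) (\<lambda>z. f (fst z) * g (snd z))"
  proof (rule lborel_pair.Fubini_integrable)
    show "integrable lborel (\<lambda>x. \<integral>y. norm (f (fst (x, y)) * g (snd (x, y))) \<partial>lborel)"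
      using f by (simp add: abs_mult)
  qed (use g in auto)
  show "integrable lborel (\<lambda>x::real^2. f (x $ i) * g (x $ j))"
    unfolding lborel_real2_eq_distr[OF ij]
    using ij int by (subst integrable_distr_eq[OF T comp]) simp
  have "(LINT x::real^2|lborel. f (x $ i) * g (x $ j)) = (LINT z|(lborel \<Otimes>\<^sub>M lborel). f (fst z) * g (snd z))"
    unfolding lborel_real2_eq_distr[OF ij]
    using ij by (subst integral_distr[OF T comp]) simp
  also have "\<dots> = (LINT x|lborel. LINT y|lborel. f (fst (x, y)) * g (snd (x, y)))"
    using lborel_pair.integral_fst'[OF int] by simp
  finally show "(LINT x::real^2|lborel. f (x $ i) * g (x $ j)) = integral\<^sup>L lborel f * integral\<^sup>L lborel g"
    by simp
qed

lemma integrable_continuous_support: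
  fixes f :: "real \<Rightarrow> real"
  assumes "continuous_on UNIV f" and "\<And>t. r < \<bar>t - c\<bar> \<Longrightarrow> f t = 0"
  shows "integrable lborel f"
proof -
  have "integrable lborel (\<lambda>t. indicator {c - r..c + r} t *\<^sub>R f t)"
    using assms(1) by (intro borel_integrable_compact) (auto intro: continuous_on_subset)
  moreover have "(\<lambda>t. indicator {c - r..c + r} t *\<^sub>R f t) = f"
  proof
    fix t
    show "indicator {c - r..c + r} t *\<^sub>R f t = f t"
      using assms(2)[of t] by (cases "t \<in> {c - r..c + r}") (auto simp: abs_real_def split: if_splits)
  qed
  ultimately show ?thesis by simp
qed

text \<open>The fundamental theorem of calculus on an interval whose endpoints lie off the support
  of \<open>F\<close>.\<close>

lemma integral_derivative_support:
  fixes F f :: "real \<Rightarrow> real"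
  assumes F: "\<And>t. (F has_real_derivative f t) (at t)" and f: "continuous_on UNIV f"
    and supp: "\<And>t. r < \<bar>t - c\<bar> \<Longrightarrow> F t = 0" "\<And>t. r < \<bar>t - c\<bar> \<Longrightarrow> f t = 0"
  shows "integral\<^sup>L lborel f = 0"
proof -
  \<comment> \<open>\<open>\<bar>r\<bar> + 1\<close> puts the endpoints strictly beyond the radius
    and in the right order for negative \<open>r\<close> too.\<close>
  let ?a = "c - \<bar>r\<bar> - 1" and ?b = "c + \<bar>r\<bar> + 1"
  have "f t = indicator {?a..?b} t *\<^sub>R f t" for t
    using supp(2)[of t] by (cases "t \<in> {?a..?b}") auto
  then have "integral\<^sup>L lborel f = (LINT t|lborel. indicator {?a..?b} t *\<^sub>R f t)"
    by presburger
  also have "\<dots> = F ?b - F ?a"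
  proof (rule integral_FTC_atLeastAtMost)
    fix t
    show "(F has_vector_derivative f t) (at t within {?a..?b})"
      using F has_vector_derivative_at_within has_real_derivative_iff_has_vector_derivative by blast
  qed (use f in \<open>auto intro: continuous_on_subset\<close>)
  also have "\<dots> = 0"
    using supp(1)[of ?a] supp(1)[of ?b] by simp
  finally show ?thesis .
qed

text \<open>Repeated integration by parts lowers the power and the order of the derivative together;
  since \<open>l < n\<close>, a derivative is still left when the power is used up, and its integral
  is zero.\<close>

lemma smooth_family_moment_eq_0:
  assumes D: "smooth_family D" and supp: "\<And>t. r < \<bar>t - c\<bar> \<Longrightarrow> D 0 t = 0" and "l < n"
  shows "(LINT t|lborel. t ^ l * D n t) = 0"
  using \<open>l < n\<close>
proof (induction l arbitrary: n)
  case 0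
  then obtain k where n: "n = Suc k" by (cases n) auto
  show ?case
    using integral_derivative_support[where F = "D k" and f = "D (Suc k)" and r = r and c = c]
      smooth_familyD[OF D] smooth_family_continuous[OF D] smooth_family_support[OF D supp]
    by (simp add: n)
next
  case (Suc l)
  then obtain k where n: "n = Suc k" by (cases n) auto
  note suppk = smooth_family_support[OF D supp]
  have cont: "continuous_on UNIV (\<lambda>t. t ^ a * D b t)" for a b
    by (intro continuous_intros smooth_family_continuous[OF D])
  have int: "integrable lborel (\<lambda>t. t ^ a * D b t)" for a b
    by (rule integrable_continuous_support[OF cont, of r c]) (use suppk in auto)
  \<comment> \<open>Integration by parts: the integrand is the derivative of
    \<open>t ^ Suc l * D k t\<close>.\<close>
  have "(LINT t|lborel. real (Suc l) * (t ^ l * D k t) + t ^ Suc l * D (Suc k) t) = 0"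
  proof (rule integral_derivative_support[where F = "\<lambda>t. t ^ Suc l * D k t" and r = r and c = c])
    fix t
    show "((\<lambda>t. t ^ Suc l * D k t) has_real_derivative real (Suc l) * (t ^ l * D k t) + t ^ Suc l * D (Suc k) t) (at t)"
      using DERIV_mult[OF DERIV_pow[of "Suc l" t UNIV] smooth_familyD[OF D, of k t]]
      by (simp add: algebra_simps)
  next
    show "continuous_on UNIV (\<lambda>t. real (Suc l) * (t ^ l * D k t) + t ^ Suc l * D (Suc k) t)"
      by (intro continuous_intros smooth_family_continuous[OF D])
  qed (use suppk in auto)
  also have "(LINT t|lborel. real (Suc l) * (t ^ l * D k t) + t ^ Suc l * D (Suc k) t)
    = real (Suc l) * (LINT t|lborel. t ^ l * D k t) + (LINT t|lborel. t ^ Suc l * D (Suc k) t)"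
    by (subst Bochner_Integration.integral_add)
       (use int[of l k] int[of "Suc l" "Suc k"] in \<open>auto simp del: power_Suc\<close>)
  finally show ?case
    using Suc.IH[of k] Suc.prems n by simp
qed

lemma tensor_has_derivative:
  fixes i j :: "'n::finite"
  assumes D: "smooth_family D" and G: "smooth_family G"
  shows "((\<lambda>x::real^'n. D a (x $ i) * G b (x $ j)) has_derivative
    (\<lambda>v. D a (x $ i) * (G (Suc b) (x $ j) * v $ j) + D (Suc a) (x $ i) * v $ i * G b (x $ j))) (at x)"
proof -
  have *: "((\<lambda>x::real^'n. H a (x $ k)) has_derivative (\<lambda>v. H (Suc a) (x $ k) * v $ k)) (at x)"
    if "smooth_family H" for H a k
  proof -
    have "(H a has_derivative (\<lambda>v. H (Suc a) (x $ k) * v)) (at (x $ k))"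
      using smooth_familyD[OF that, of a "x $ k"] by (simp add: has_field_derivative_def)
    moreover have "((\<lambda>x::real^'n. x $ k) has_derivative (\<lambda>v. v $ k)) (at x)"
      by (rule bounded_linear_imp_has_derivative) (rule bounded_linear_vec_nth)
    ultimately show ?thesis
      using has_derivative_compose by blast
  qed
  show ?thesis
    by (rule has_derivative_mult[OF *[OF D] *[OF G]])
qed

lemma partial_tensor:
  fixes i j :: "'n::finite"
  assumes "smooth_family D" "smooth_family G" "i \<noteq> j"
  shows "partial k (\<lambda>x::real^'n. D a (x $ i) * G b (x $ j)) =
    (if k = i then (\<lambda>x. D (Suc a) (x $ i) * G b (x $ j))
     else if k = j then (\<lambda>x. D a (x $ i) * G (Suc b) (x $ j)) else (\<lambda>x. 0))"
proof -
  have "frechet_derivative (\<lambda>x::real^'n. D a (x $ i) * G b (x $ j)) (at x) =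
    (\<lambda>v. D a (x $ i) * (G (Suc b) (x $ j) * v $ j) + D (Suc a) (x $ i) * v $ i * G b (x $ j))" for x
    by (rule frechet_derivative_at[OF tensor_has_derivative[OF assms(1,2)], symmetric])
  then show ?thesis
    using assms(3) by (simp add: partial_def fun_eq_iff axis_def)
qed

lemma partials_replicate_tensor:
  fixes i j :: "'n::finite"
  assumes "smooth_family D" "smooth_family G" "i \<noteq> j"
  shows "partials (replicate m i) (\<lambda>x::real^'n. D a (x $ i) * G b (x $ j)) =
    (\<lambda>x. D (a + m) (x $ i) * G b (x $ j))"
  by (induction m) (simp_all add: partial_tensor[OF assms])

text \<open>Products of members of the two families are closed under partial derivatives, since in
  the plane every coordinate direction is \<open>i\<close> or \<open>j\<close>.\<close>

lemma test_function_tensor: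
  fixes i j :: 2
  assumes D: "smooth_family D" and G: "smooth_family G" and ij: "i \<noteq> j"
    and K: "compact K" "K \<subseteq> S" "\<And>x. x \<notin> K \<Longrightarrow> D a (x $ i) * G b (x $ j) = 0"
  shows "test_function S (\<lambda>x. D a (x $ i) * G b (x $ j))"
proof -
  have "\<exists>a' b'. partials is (\<lambda>x. D a (x $ i) * G b (x $ j)) = (\<lambda>x. D a' (x $ i) * G b' (x $ j))" for "is"
  proof (induction "is")
    case (Cons k "is")
    then obtain a' b' where
      IH: "partials is (\<lambda>x. D a (x $ i) * G b (x $ j)) = (\<lambda>x. D a' (x $ i) * G b' (x $ j))"
      by blast
    have "k = i \<or> k = j"
      using UNIV_2_eq[OF ij] by blast
    then show ?case
      by (auto simp: IH partial_tensor[OF D G ij])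
  qed auto
  moreover have "(\<lambda>x. D a' (x $ i) * G b' (x $ j)) differentiable (at x)" for a' b' x
    using tensor_has_derivative[OF D G] differentiable_def by blast
  ultimately show ?thesis
    unfolding test_function_def using K by metis
qed

subsection \<open>Pairings with square-integrable functions\<close>

text \<open>The Cauchy-Schwarz inequality against the indicator of \<open>Q\<close>, obtained from a
  nonnegative quadratic polynomial in \<open>t\<close>.\<close>

lemma integral_abs_power2_le:
  fixes f :: "'a \<Rightarrow> real"
  assumes Q: "Q \<in> sets M" "emeasure M Q < \<infinity>" and f: "f \<in> borel_measurable M"
    and int: "integrable M (\<lambda>x. (f x)\<^sup>2)" and supp: "\<And>x. x \<notin> Q \<Longrightarrow> f x = 0"
  shows "integrable M f" "(LINT x|M. \<bar>f x\<bar>)\<^sup>2 \<le> measure M Q * (LINT x|M. (f x)\<^sup>2)"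
proof -
  have Qint: "integrable M (indicator Q :: 'a \<Rightarrow> real)"
    using Q by (simp add: integrable_indicator_iff)
  have Qval: "integral\<^sup>L M (indicator Q :: 'a \<Rightarrow> real) = measure M Q"
    using Q by (simp add: emeasure_notin_sets)
  show f_int: "integrable M f"
  proof (rule Bochner_Integration.integrable_bound)
    show "integrable M (\<lambda>x. (f x)\<^sup>2 + indicator Q x)"
      using int Qint by simp
    show "AE x in M. norm (f x) \<le> norm ((f x)\<^sup>2 + indicator Q x)"
    proof (rule AE_I2)
      fix x
      have "2 * \<bar>f x\<bar> \<le> (f x)\<^sup>2 + 1"
        using sum_squares_bound[of "\<bar>f x\<bar>" 1] by simp
      then show "norm (f x) \<le> norm ((f x)\<^sup>2 + indicator Q x)"
        using supp[of x] by (cases "x \<in> Q") auto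
    qed
  qed (rule f)
  let ?I = "LINT x|M. \<bar>f x\<bar>"
  have poly: "0 \<le> (LINT x|M. (f x)\<^sup>2) - 2 * t * ?I + t\<^sup>2 * measure M Q" for t
  proof -
    have "0 \<le> (LINT x|M. (\<bar>f x\<bar> - t * indicator Q x)\<^sup>2)"
      by simp
    also have "(\<lambda>x. (\<bar>f x\<bar> - t * indicator Q x)\<^sup>2) = (\<lambda>x. (f x)\<^sup>2 - 2 * t * \<bar>f x\<bar> + t\<^sup>2 * indicator Q x)"
    proof
      fix x
      show "(\<bar>f x\<bar> - t * indicator Q x)\<^sup>2 = (f x)\<^sup>2 - 2 * t * \<bar>f x\<bar> + t\<^sup>2 * indicator Q x"
      proof (cases "x \<in> Q")
        case True
        then show ?thesis by (simp add: power2_diff mult_ac)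
      qed (simp add: supp)
    qed
    also have "(LINT x|M. (f x)\<^sup>2 - 2 * t * \<bar>f x\<bar> + t\<^sup>2 * indicator Q x)
      = (LINT x|M. (f x)\<^sup>2) - 2 * t * ?I + t\<^sup>2 * measure M Q"
    proof -
      have "integrable M (\<lambda>x. 2 * t * \<bar>f x\<bar>)" "integrable M (\<lambda>x. t\<^sup>2 * indicator Q x)"
        using f_int Qint by simp_all
      then have "(LINT x|M. (f x)\<^sup>2 - 2 * t * \<bar>f x\<bar> + t\<^sup>2 * indicator Q x)
        = (LINT x|M. (f x)\<^sup>2) - (LINT x|M. 2 * t * \<bar>f x\<bar>) + (LINT x|M. t\<^sup>2 * indicator Q x)"
        using int by (simp only: Bochner_Integration.integral_add Bochner_Integration.integral_diff
            Bochner_Integration.integrable_diff)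
      then show ?thesis
        by (simp only: integral_mult_right_zero Qval)
    qed
    finally show ?thesis .
  qed
  show "?I\<^sup>2 \<le> measure M Q * (LINT x|M. (f x)\<^sup>2)"
  proof (cases "measure M Q = 0")
    case True
    then have "Q \<in> null_sets M"
      using Q by (simp add: null_setsI emeasure_eq_ennreal_measure)
    from AE_not_in[OF this] have "AE x in M. \<bar>f x\<bar> = 0"
      by eventually_elim (simp add: supp)
    then have "?I = 0"
      by (rule integral_eq_zero_AE)
    then show ?thesis by (simp add: True)
  next
    case False
    then have pos: "measure M Q > 0"
      by (simp add: zero_less_measure_iff)
    then show ?thesis
    proof -
      \<comment> \<open>The quadratic is evaluated at its minimum.\<close>
      have "0 \<le> (LINT x|M. (f x)\<^sup>2) - ?I\<^sup>2 / measure M Q"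
        using poly[of "?I / measure M Q"] pos by (simp add: power2_eq_square)
      then show ?thesis
        using pos by (simp add: pos_divide_le_eq mult.commute)
    qed
  qed
qed

lemma L2_onD:
  fixes f :: "'a::euclidean_space \<Rightarrow> real"
  assumes "L2_on S f"
  shows "(\<lambda>x. indicator S x * f x) \<in> borel_measurable lebesgue"
    "integrable lebesgue (\<lambda>x. (indicator S x * f x)\<^sup>2)"
proof -
  have "(\<lambda>x. indicator S x * (f x)\<^sup>2) = (\<lambda>x. (indicator S x * f x)\<^sup>2)"
    by (auto simp: indicator_def)
  then show "(\<lambda>x. indicator S x * f x) \<in> borel_measurable lebesgue"
    "integrable lebesgue (\<lambda>x. (indicator S x * f x)\<^sup>2)"
    using assms by (simp_all add: L2_on_def set_borel_measurable_def set_integrable_def)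
qed

text \<open>Cauchy-Schwarz on \<open>Q\<close> together with the bound \<open>B\<close> on
  \<open>\<psi>\<close>. The measure of \<open>Q\<close> is kept explicit because \<open>Q\<close>
  will shrink with the mesh.\<close>

lemma L2_on_pairing_le:
  fixes f \<psi> :: "'a::euclidean_space \<Rightarrow> real"
  assumes f: "L2_on S f" and Q: "Q \<in> lmeasurable" "Q \<subseteq> S"
    and \<psi>: "\<psi> \<in> borel_measurable borel" "\<And>x. \<bar>\<psi> x\<bar> \<le> B" "\<And>x. x \<notin> Q \<Longrightarrow> \<psi> x = 0"
  shows "set_integrable lebesgue S (\<lambda>x. f x * \<psi> x)"
    and "\<bar>LINT x:S|lebesgue. f x * \<psi> x\<bar> \<le> B * sqrt (measure lebesgue Q * (LINT x:S|lebesgue. (f x)\<^sup>2))"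
proof -
  \<comment> \<open>Measurability is known only for the product of \<open>f\<close> with the
    indicator of \<open>S\<close>, hence the double cut-off.\<close>
  define F where "F = (\<lambda>x. indicator Q x * (indicator S x * f x))"
  have B: "B \<ge> 0"
    using \<psi>(2)[of 0] by linarith
  have [measurable]: "\<psi> \<in> borel_measurable lebesgue" "Q \<in> sets lebesgue"
      "(\<lambda>x. indicator S x * f x) \<in> borel_measurable lebesgue"
    using \<psi>(1) Q(1) L2_onD(1)[OF f] by (auto intro: measurable_completion)
  have [measurable]: "F \<in> borel_measurable lebesgue"
    unfolding F_def by measurable
  have Fsq: "integrable lebesgue (\<lambda>x. (F x)\<^sup>2)"
  proof (rule Bochner_Integration.integrable_bound[OF L2_onD(2)[OF f]])
    show "AE x in lebesgue. norm ((F x)\<^sup>2) \<le> norm ((indicator S x * f x)\<^sup>2)"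
      by (auto simp: F_def indicator_def)
  qed measurable
  have Qfin: "emeasure lebesgue Q < \<infinity>"
    using Q(1) fmeasurableD2 top.not_eq_extremum by (auto simp: fmeasurable_def)
  have Fint: "integrable lebesgue F" and
    Fle: "(LINT x|lebesgue. \<bar>F x\<bar>)\<^sup>2 \<le> measure lebesgue Q * (LINT x|lebesgue. (F x)\<^sup>2)"
    by (rule integral_abs_power2_le[OF _ Qfin _ Fsq]; simp add: F_def)+
  have eq: "indicator S x * (f x * \<psi> x) = F x * \<psi> x" for x
    using \<psi>(3)[of x] by (cases "x \<in> Q") (auto simp: F_def)
  have bound: "norm (F x * \<psi> x) \<le> B * norm (F x)" for x
    using mult_right_mono[OF \<psi>(2)[of x], of "\<bar>F x\<bar>"] by (simp add: abs_mult mult.commute)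
  have prod_int: "integrable lebesgue (\<lambda>x. F x * \<psi> x)"
  proof (rule Bochner_Integration.integrable_bound)
    show "integrable lebesgue (\<lambda>x. B * F x)" using Fint by simp
    show "AE x in lebesgue. norm (F x * \<psi> x) \<le> norm (B * F x)"
      using bound B by (simp add: abs_mult)
  qed simp
  then show "set_integrable lebesgue S (\<lambda>x. f x * \<psi> x)"
    by (simp add: set_integrable_def eq)
  have "\<bar>LINT x:S|lebesgue. f x * \<psi> x\<bar> = \<bar>LINT x|lebesgue. F x * \<psi> x\<bar>"
    by (simp add: set_lebesgue_integral_def eq)
  also have "\<dots> \<le> (LINT x|lebesgue. \<bar>F x * \<psi> x\<bar>)"
    by (rule integral_abs_bound)
  also have "\<dots> \<le> (LINT x|lebesgue. B * \<bar>F x\<bar>)"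
    using bound by (intro Bochner_Integration.integral_mono integrable_abs integrable_mult_right prod_int Fint) simp_all
  also have "\<dots> = B * (LINT x|lebesgue. \<bar>F x\<bar>)"
    by simp
  also have "(LINT x|lebesgue. \<bar>F x\<bar>) \<le> sqrt (measure lebesgue Q * (LINT x|lebesgue. (F x)\<^sup>2))"
    by (rule real_le_rsqrt[OF Fle])
  also have "(LINT x|lebesgue. (F x)\<^sup>2) \<le> (LINT x|lebesgue. (indicator S x * f x)\<^sup>2)"
    by (rule integral_mono[OF Fsq L2_onD(2)[OF f]]) (auto simp: F_def indicator_def)
  also have "(LINT x|lebesgue. (indicator S x * f x)\<^sup>2) = (LINT x:S|lebesgue. (f x)\<^sup>2)"
    unfolding set_lebesgue_integral_def
    by (rule Bochner_Integration.integral_cong) (auto simp: indicator_def)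
  finally show "\<bar>LINT x:S|lebesgue. f x * \<psi> x\<bar> \<le> B * sqrt (measure lebesgue Q * (LINT x:S|lebesgue. (f x)\<^sup>2))"
    using B by (simp add: mult_left_mono)
qed

text \<open>Since \<open>\<psi>\<close> has mean zero, \<open>\<integral> g \<psi> = \<integral> (g - g x) \<psi>\<close> for every \<open>x \<in> Q\<close>; averaging the
  square over \<open>x\<close> produces the seminorm without any measurability of the inner integral.\<close>

lemma gagliardo_pairing_le:
  fixes g \<psi> :: "real ^ 'n::finite \<Rightarrow> real"
  assumes g: "L2_on S g" and Q: "Q \<in> lmeasurable" "Q \<subseteq> S" "measure lebesgue Q > 0"
    and d: "d > 0" "\<And>x y. x \<in> Q \<Longrightarrow> y \<in> Q \<Longrightarrow> norm (x - y) \<le> d"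
    and \<psi>: "\<psi> \<in> borel_measurable borel" "\<And>x. \<bar>\<psi> x\<bar> \<le> B" "\<And>x. x \<notin> Q \<Longrightarrow> \<psi> x = 0"
      "integral\<^sup>L lebesgue \<psi> = 0"
    and \<sigma>: "\<sigma> \<ge> 0"
  shows "ennreal ((LINT x:S|lebesgue. g x * \<psi> x)\<^sup>2) \<le> ennreal (B\<^sup>2 * d powr (real CARD('n) + 2 * \<sigma>)) *
    (\<integral>\<^sup>+x\<in>S. (\<integral>\<^sup>+y\<in>S.
        ennreal ((g x - g y)\<^sup>2 / norm (x - y) powr (real CARD('n) + 2 * \<sigma>)) \<partial>lebesgue) \<partial>lebesgue)"
    (is "_ \<le> _ * ?G")
proof -
  let ?p = "real CARD('n) + 2 * \<sigma>"
  let ?A = "LINT x:S|lebesgue. g x * \<psi> x"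
  \<comment> \<open>Integrated over \<open>Q\<close>, this constant gives the claimed bound; for
    \<open>B = 0\<close> it is zero by the convention on division.\<close>
  let ?c = "?A\<^sup>2 / (B\<^sup>2 * measure lebesgue Q * d powr ?p)"
  define F where "F = (\<lambda>x. indicator Q x * (indicator S x * g x))"
  have [measurable]: "\<psi> \<in> borel_measurable lebesgue" "Q \<in> sets lebesgue"
      "(\<lambda>x. indicator S x * g x) \<in> borel_measurable lebesgue"
    using \<psi>(1) Q(1) L2_onD(1)[OF g] by (auto intro: measurable_completion)
  have [measurable]: "F \<in> borel_measurable lebesgue"
    unfolding F_def by measurable
  have Qfin: "emeasure lebesgue Q < \<infinity>"
    using Q(1) by (auto simp: fmeasurable_def)
  have Qint: "integrable lebesgue (\<lambda>x. indicator Q x :: real)"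
    using Qfin by (simp add: integrable_indicator_iff)
  have Fsq: "integrable lebesgue (\<lambda>x. (F x)\<^sup>2)"
  proof (rule Bochner_Integration.integrable_bound[OF L2_onD(2)[OF g]])
    show "AE x in lebesgue. norm ((F x)\<^sup>2) \<le> norm ((indicator S x * g x)\<^sup>2)"
      by (auto simp: F_def indicator_def)
  qed measurable
  have Fint: "integrable lebesgue F"
    by (rule integral_abs_power2_le(1)[OF _ Qfin _ Fsq]) (simp_all add: F_def)
  have Feq: "F x = g x" if "x \<in> Q" for x
    using that Q(2) by (auto simp: F_def)
  have B: "B \<ge> 0"
    using \<psi>(2)[of 0] by linarith
  have \<psi>int: "integrable lebesgue \<psi>"
  proof (rule Bochner_Integration.integrable_bound)
    show "integrable lebesgue (\<lambda>x. B * indicator Q x)" using Qint by simp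
    show "AE x in lebesgue. norm (\<psi> x) \<le> norm (B * indicator Q x)"
      using \<psi>(2,3) B by (auto simp: indicator_def)
  qed simp
  have Ale: "ennreal ?c \<le> (\<integral>\<^sup>+y\<in>S. ennreal ((g x - g y)\<^sup>2 / norm (x - y) powr ?p) \<partial>lebesgue)"
    if x: "x \<in> Q" for x
  proof -
    define H where "H = (\<lambda>y. F y - g x * indicator Q y)"
    have [measurable]: "H \<in> borel_measurable lebesgue"
      unfolding H_def by measurable
    have Hsq: "integrable lebesgue (\<lambda>y. (H y)\<^sup>2)"
    proof -
      have "(H y)\<^sup>2 = (F y)\<^sup>2 - 2 * g x * F y + (g x)\<^sup>2 * indicator Q y" for y
        by (cases "y \<in> Q") (auto simp: H_def F_def power2_diff algebra_simps)
      then show ?thesis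
        using Fsq Fint Qint by simp
    qed
    have H0: "H y = 0" if "y \<notin> Q" for y
      using that by (simp add: H_def F_def)
    have Hint: "integrable lebesgue H" and
      Hle: "(LINT y|lebesgue. \<bar>H y\<bar>)\<^sup>2 \<le> measure lebesgue Q * (LINT y|lebesgue. (H y)\<^sup>2)"
      by (rule integral_abs_power2_le[OF _ Qfin _ Hsq]; simp add: H0)+
    have eq: "indicator S y * (g y * \<psi> y) = H y * \<psi> y + g x * \<psi> y" for y
      using \<psi>(3)[of y] Q(2) by (cases "y \<in> Q") (auto simp: H_def Feq algebra_simps)
    have bound: "norm (H x * \<psi> x) \<le> B * norm (H x)" for x
      using mult_right_mono[OF \<psi>(2)[of x], of "\<bar>H x\<bar>"] by (simp add: abs_mult mult.commute)
    have H\<psi>: "integrable lebesgue (\<lambda>y. H y * \<psi> y)"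
    proof (rule Bochner_Integration.integrable_bound)
      show "integrable lebesgue (\<lambda>x. B * H x)" using Hint by simp
      show "AE x in lebesgue. norm (H x * \<psi> x) \<le> norm (B * H x)"
        using bound B by (simp add: abs_mult)
    qed simp
    \<comment> \<open>The term with the constant \<open>g x\<close> drops out because
      \<open>\<psi>\<close> has integral zero.\<close>
    have "?A = (LINT y|lebesgue. H y * \<psi> y)"
      using \<psi>int H\<psi> \<psi>(4) by (simp add: set_lebesgue_integral_def eq)
    then have "\<bar>?A\<bar> \<le> (LINT y|lebesgue. \<bar>H y * \<psi> y\<bar>)"
      using integral_abs_bound by metis
    also have "\<dots> \<le> (LINT y|lebesgue. B * \<bar>H y\<bar>)"
        using bound by (intro Bochner_Integration.integral_mono integrable_abs integrable_mult_right H\<psi> Hint) simp_all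
    also have "\<dots> = B * (LINT y|lebesgue. \<bar>H y\<bar>)" by simp
    finally have "\<bar>?A\<bar>\<^sup>2 \<le> (B * (LINT y|lebesgue. \<bar>H y\<bar>))\<^sup>2"
      by (rule power_mono) simp
    also have "\<dots> \<le> B\<^sup>2 * (measure lebesgue Q * (LINT y|lebesgue. (H y)\<^sup>2))"
      unfolding power_mult_distrib by (rule mult_left_mono[OF Hle]) simp
    finally have "?A\<^sup>2 \<le> (B\<^sup>2 * measure lebesgue Q) * (LINT y|lebesgue. (H y)\<^sup>2)"
      by simp
    then have "?c \<le> (LINT y|lebesgue. (H y)\<^sup>2) / d powr ?p"
      using Q(3) d(1) by (cases "B = 0") (auto simp: field_simps)
    also have "\<dots> = (LINT y|lebesgue. (H y)\<^sup>2 / d powr ?p)" by simp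
    finally have "ennreal ?c \<le> ennreal (LINT y|lebesgue. (H y)\<^sup>2 / d powr ?p)"
      by (rule ennreal_leI)
    also have "\<dots> = (\<integral>\<^sup>+y. ennreal ((H y)\<^sup>2 / d powr ?p) \<partial>lebesgue)"
      by (rule nn_integral_eq_integral[symmetric]) (use Hsq in auto)
    also have "\<dots> \<le> (\<integral>\<^sup>+y\<in>S. ennreal ((g x - g y)\<^sup>2 / norm (x - y) powr ?p) \<partial>lebesgue)"
    proof (rule nn_integral_mono)
      fix y
      show "ennreal ((H y)\<^sup>2 / d powr ?p) \<le> ennreal ((g x - g y)\<^sup>2 / norm (x - y) powr ?p) * indicator S y"
      \<comment> \<open>At \<open>y = x\<close> the quotient is \<open>0 / 0\<close>, but
        \<open>H\<close> vanishes there too.\<close>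
      proof (cases "y \<in> Q \<and> y \<noteq> x")
        case True
        then have "norm (x - y) powr ?p \<le> d powr ?p"
          using d x \<sigma> by (intro powr_mono2) auto
        moreover have "norm (x - y) powr ?p > 0"
          using True by (metis norm_eq_zero powr_gt_zero right_minus_eq)
        ultimately have "(g x - g y)\<^sup>2 / d powr ?p \<le> (g x - g y)\<^sup>2 / norm (x - y) powr ?p"
          using d(1) by (intro divide_left_mono mult_pos_pos) auto
        moreover have "(H y)\<^sup>2 = (g x - g y)\<^sup>2"
          using True by (simp add: H_def Feq power2_commute)
        ultimately show ?thesis
          using True Q(2) by (auto intro!: ennreal_leI)
      next
        case False
        then have "H y = 0"
          using H0[of y] x Feq[of x] by (auto simp: H_def)
        then show ?thesis by simp
      qed
    qed
    finally show ?thesis .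
  qed
  have "ennreal (?A\<^sup>2) = ennreal (B\<^sup>2 * d powr ?p) * (ennreal ?c * emeasure lebesgue Q)"
  proof (cases "B = 0")
    case True
    then have "\<psi> = (\<lambda>_. 0)"
      using \<psi>(2) by (auto simp: fun_eq_iff)
    then show ?thesis by (simp add: True)
  next
    case False
    have "emeasure lebesgue Q = ennreal (measure lebesgue Q)"
      using Q(1) emeasure_eq_measure2 by blast
    then have "ennreal (B\<^sup>2 * d powr ?p) * (ennreal ?c * emeasure lebesgue Q) =
      ennreal (B\<^sup>2 * d powr ?p * (?c * measure lebesgue Q))"
      by (simp only: ennreal_mult''[OF measure_nonneg, symmetric])
        (rule ennreal_mult''[symmetric], simp)
    also have "B\<^sup>2 * d powr ?p * (?c * measure lebesgue Q) = ?A\<^sup>2"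
      using False Q(3) d(1) by (simp add: field_simps)
    finally show ?thesis by simp
  qed
  also have "ennreal ?c * emeasure lebesgue Q = (\<integral>\<^sup>+x. ennreal ?c * indicator Q x \<partial>lebesgue)"
    by (simp add: nn_integral_cmult_indicator)
  also have "\<dots> \<le> ?G"
    using Ale Q(2) by (intro nn_integral_mono) (auto simp: indicator_def)
  finally show ?thesis
    by (simp add: mult_left_mono)
qed

text \<open>One constant is fixed before \<open>Q\<close>, \<open>\<psi>\<close> and
  \<open>d\<close>, so that it serves all meshes. For \<open>\<sigma> = 0\<close> it comes from
  Cauchy-Schwarz, where \<open>measure lebesgue Q \<le> d\<^sup>2\<close> supplies the factor
  \<open>d\<close>; for \<open>\<sigma> > 0\<close> it is the square root of the Gagliardo
  integral.\<close>

lemma sobolev_pairing_le: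
  fixes g :: "real ^ 2 \<Rightarrow> real"
  assumes g: "L2_on S g" and gag: "0 < \<sigma> \<Longrightarrow> finite_gagliardo \<sigma> S g" and \<sigma>: "\<sigma> \<ge> 0"
  shows "\<exists>C\<ge>0. \<forall>Q \<psi> B d. Q \<in> lmeasurable \<and> Q \<subseteq> S \<and>
      0 < measure lebesgue Q \<and> measure lebesgue Q \<le> d\<^sup>2 \<and>
      0 < d \<and> (\<forall>x\<in>Q. \<forall>y\<in>Q. norm (x - y) \<le> d) \<and>
      \<psi> \<in> borel_measurable borel \<and> (\<forall>x. \<bar>\<psi> x\<bar> \<le> B) \<and> (\<forall>x. x \<notin> Q \<longrightarrow> \<psi> x = 0) \<and>
      integral\<^sup>L lebesgue \<psi> = 0 \<longrightarrow>
      \<bar>LINT x:S|lebesgue. g x * \<psi> x\<bar> \<le> C * B * d powr (1 + \<sigma>)"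
proof (cases "\<sigma> = 0")
  case True
  show ?thesis
  proof (intro exI[of _ "sqrt (LINT x:S|lebesgue. (g x)\<^sup>2)"] conjI allI impI; (elim conjE)?)
    have "0 \<le> (LINT x:S|lebesgue. (g x)\<^sup>2)"
      unfolding set_lebesgue_integral_def by (intro Bochner_Integration.integral_nonneg) auto
    then show "sqrt (LINT x:S|lebesgue. (g x)\<^sup>2) \<ge> 0" by simp
    fix Q :: "(real ^ 2) set" and \<psi> :: "real ^ 2 \<Rightarrow> real" and B d :: real
    assume Q: "Q \<in> lmeasurable" "Q \<subseteq> S" "measure lebesgue Q \<le> d\<^sup>2" and d: "d > 0"
      and \<psi>: "\<psi> \<in> borel_measurable borel" "\<forall>x. \<bar>\<psi> x\<bar> \<le> B" "\<forall>x. x \<notin> Q \<longrightarrow> \<psi> x = 0"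
    have B: "B \<ge> 0"
      using \<psi>(2)[rule_format, of 0] by linarith
    have "\<bar>LINT x:S|lebesgue. g x * \<psi> x\<bar> \<le> B * (sqrt (measure lebesgue Q) * sqrt (LINT x:S|lebesgue. (g x)\<^sup>2))"
      using L2_on_pairing_le(2)[OF g Q(1,2) \<psi>[rule_format]] by (simp add: real_sqrt_mult)
    also have "\<dots> \<le> B * (d * sqrt (LINT x:S|lebesgue. (g x)\<^sup>2))"
      using Q(3) d B \<open>0 \<le> (LINT x:S|lebesgue. (g x)\<^sup>2)\<close>
      by (intro mult_left_mono mult_right_mono real_le_lsqrt) auto
    finally show "\<bar>LINT x:S|lebesgue. g x * \<psi> x\<bar> \<le> sqrt (LINT x:S|lebesgue. (g x)\<^sup>2) * B * d powr (1 + \<sigma>)"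
      using d by (simp add: True mult_ac)
  qed
next
  case False
  let ?G = "\<integral>\<^sup>+x\<in>S. (\<integral>\<^sup>+y\<in>S.
        ennreal ((g x - g y)\<^sup>2 / norm (x - y) powr (real CARD(2) + 2 * \<sigma>)) \<partial>lebesgue) \<partial>lebesgue"
  have Gfin: "?G < \<infinity>"
    using gag \<sigma> False by (simp add: finite_gagliardo_def)
  define K where "K = enn2real ?G"
  have G: "?G = ennreal K" and K: "K \<ge> 0"
    using Gfin by (auto simp: K_def ennreal_enn2real)
  show ?thesis
  proof (intro exI[of _ "sqrt K"] conjI allI impI; (elim conjE)?)
    show "sqrt K \<ge> 0" using K by simp
    fix Q :: "(real ^ 2) set" and \<psi> :: "real ^ 2 \<Rightarrow> real" and B d :: real
    assume Q: "Q \<in> lmeasurable" "Q \<subseteq> S" "measure lebesgue Q > 0"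
      and d: "d > 0" "\<forall>x\<in>Q. \<forall>y\<in>Q. norm (x - y) \<le> d"
      and \<psi>: "\<psi> \<in> borel_measurable borel" "\<forall>x. \<bar>\<psi> x\<bar> \<le> B" "\<forall>x. x \<notin> Q \<longrightarrow> \<psi> x = 0"
        "integral\<^sup>L lebesgue \<psi> = 0"
    have B: "B \<ge> 0"
      using \<psi>(2)[rule_format, of 0] by linarith
    have "ennreal ((LINT x:S|lebesgue. g x * \<psi> x)\<^sup>2) \<le> ennreal (B\<^sup>2 * d powr (real CARD(2) + 2 * \<sigma>)) * ?G"
      by (rule gagliardo_pairing_le[OF g Q d[rule_format] \<psi>[rule_format] \<sigma>])
    also have "\<dots> = ennreal (B\<^sup>2 * d powr (real CARD(2) + 2 * \<sigma>) * K)"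
      unfolding G using K by (simp add: ennreal_mult'')
    finally have "(LINT x:S|lebesgue. g x * \<psi> x)\<^sup>2 \<le> B\<^sup>2 * d powr (real CARD(2) + 2 * \<sigma>) * K"
      using K by (subst (asm) ennreal_le_iff) auto
    \<comment> \<open>In dimension two the exponent is exactly twice
      \<open>1 + \<sigma>\<close>.\<close>
    also have "d powr (real CARD(2) + 2 * \<sigma>) = (d powr (1 + \<sigma>))\<^sup>2"
      by (simp add: power2_eq_square powr_add[symmetric])
    also have "B\<^sup>2 * (d powr (1 + \<sigma>))\<^sup>2 * K = (sqrt K * B * d powr (1 + \<sigma>))\<^sup>2"
      using K by (simp add: power_mult_distrib)
    finally show "\<bar>LINT x:S|lebesgue. g x * \<psi> x\<bar> \<le> sqrt K * B * d powr (1 + \<sigma>)"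
      using K B by (simp add: abs_le_square_iff[symmetric])
  qed
qed

subsection \<open>Finite differences\<close>

text \<open>The type class \<open>plus\<close> lets one definition serve both points of the plane
  and parameters along a ray.\<close>

definition shift_diff :: "'a::plus \<Rightarrow> ('a \<Rightarrow> real) \<Rightarrow> 'a \<Rightarrow> real" where
  "shift_diff v f = (\<lambda>y. f (y + v) - f y)"

lemma shift_diff_funpow_Suc:
  "(shift_diff v ^^ Suc n) f = (\<lambda>y. (shift_diff v ^^ n) f (y + v) - (shift_diff v ^^ n) f y)"
proof -
  have "(shift_diff v ^^ Suc n) f = shift_diff v ((shift_diff v ^^ n) f)"
    by simp
  then show ?thesis
    by (simp only: shift_diff_def[of v "(shift_diff v ^^ n) f"])
qed

lemma shift_diff_add: "shift_diff v (\<lambda>y. f y + g y) = (\<lambda>y. shift_diff v f y + shift_diff v g y)"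
  by (simp add: shift_diff_def fun_eq_iff)

lemma shift_diff_funpow_add:
  "(shift_diff v ^^ n) (\<lambda>y. f y + g y) = (\<lambda>y. (shift_diff v ^^ n) f y + (shift_diff v ^^ n) g y)"
  by (induction n) (simp_all add: shift_diff_add)

text \<open>The \<open>n\<close>-th difference reads a function only at its \<open>n + 1\<close>
  nodes. This permits replacing a cut-off function by its uncut formula as long as the nodes lie
  inside the cut-off.\<close>

lemma shift_diff_funpow_cong:
  fixes f :: "'a::real_vector \<Rightarrow> real"
  assumes "\<And>j. j \<le> n \<Longrightarrow> f (y + real j *\<^sub>R v) = g (y + real j *\<^sub>R v)"
  shows "(shift_diff v ^^ n) f y = (shift_diff v ^^ n) g y"
  using assms
proof (induction n arbitrary: y)
  case (Suc n)
  have "(shift_diff v ^^ n) f (y + v) = (shift_diff v ^^ n) g (y + v)"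
  proof (rule Suc.IH)
    fix j assume "j \<le> n"
    then show "f (y + v + real j *\<^sub>R v) = g (y + v + real j *\<^sub>R v)"
      using Suc.prems[of "Suc j"] by (simp add: algebra_simps)
  qed
  moreover have "(shift_diff v ^^ n) f y = (shift_diff v ^^ n) g y"
    using Suc by simp
  ultimately show ?case
    by (simp only: shift_diff_funpow_Suc)
qed (use assms in simp)

lemma shift_diff_funpow_line:
  fixes f :: "'a::real_vector \<Rightarrow> real"
  shows "(shift_diff (\<tau> *\<^sub>R e) ^^ n) f (t *\<^sub>R e) = (shift_diff \<tau> ^^ n) (\<lambda>s. f (s *\<^sub>R e)) t"
proof (induction n arbitrary: t)
  case (Suc n)
  have "t *\<^sub>R e + \<tau> *\<^sub>R e = (t + \<tau>) *\<^sub>R e"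
    by (simp add: scaleR_left_distrib)
  then show ?case
    unfolding shift_diff_funpow_Suc using Suc by simp
qed simp

text \<open>Continuity is asked only at the nodes, because this is applied to a cut-off function
  that may jump elsewhere.\<close>

lemma isCont_shift_diff_funpow:
  fixes f :: "'a::real_normed_vector \<Rightarrow> real"
  assumes "\<And>j. j \<le> n \<Longrightarrow> isCont f (y + real j *\<^sub>R v)"
  shows "isCont ((shift_diff v ^^ n) f) y"
  using assms
proof (induction n arbitrary: y)
  case (Suc n)
  have "isCont ((shift_diff v ^^ n) f) (y + v)"
  proof (rule Suc.IH)
    fix j assume "j \<le> n"
    then show "isCont f (y + v + real j *\<^sub>R v)"
      using Suc.prems[of "Suc j"] by (simp add: algebra_simps)
  qed
  then have "isCont (\<lambda>z. (shift_diff v ^^ n) f (z + v)) y"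
    using isCont_o2[where f = "\<lambda>z. z + v" and g = "(shift_diff v ^^ n) f" and a = y] by simp
  moreover have "isCont ((shift_diff v ^^ n) f) y"
    using Suc by simp
  ultimately show ?case
    unfolding shift_diff_funpow_Suc by (rule continuous_diff)
qed (use assms in simp)

lemma shift_diff_funpow_DERIV:
  fixes D :: "nat \<Rightarrow> real \<Rightarrow> real"
  assumes "\<And>k t. 0 < t \<Longrightarrow> (D k has_real_derivative D (Suc k) t) (at t)" "\<tau> > 0" "t > 0"
  shows "((shift_diff \<tau> ^^ n) (D k) has_real_derivative (shift_diff \<tau> ^^ n) (D (Suc k)) t) (at t)"
  using \<open>t > 0\<close>
proof (induction n arbitrary: t)
  case (Suc n)
  have "((\<lambda>t. (shift_diff \<tau> ^^ n) (D k) (t + \<tau>)) has_real_derivative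
      (shift_diff \<tau> ^^ n) (D (Suc k)) (t + \<tau>)) (at t)"
    using Suc.IH[of "t + \<tau>"] Suc.prems assms(2) by (subst DERIV_shift[symmetric]) simp
  from DERIV_diff[OF this Suc.IH[OF Suc.prems]] show ?case
    by (simp only: shift_diff_funpow_Suc)
qed (use assms(1) in simp)

text \<open>Differencing commutes with differentiation, so the induction hypothesis for the shifted
  family makes the \<open>n\<close>-th difference strictly increasing, and one further difference is
  positive.\<close>

lemma shift_diff_funpow_pos:
  fixes D :: "nat \<Rightarrow> real \<Rightarrow> real"
  assumes "\<And>k t. 0 < t \<Longrightarrow> (D k has_real_derivative D (Suc k) t) (at t)" "\<tau> > 0"
    and "\<And>t. 0 < t \<Longrightarrow> D n t > 0" "t > 0"
  shows "(shift_diff \<tau> ^^ n) (D 0) t > 0"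
  using assms(1,3,4)
proof (induction n arbitrary: D t)
  case (Suc n)
  have "(shift_diff \<tau> ^^ n) (D 0) t < (shift_diff \<tau> ^^ n) (D 0) (t + \<tau>)"
  proof (rule DERIV_pos_imp_increasing[where f = "(shift_diff \<tau> ^^ n) (D 0)"])
    fix x assume x: "t \<le> x" "x \<le> t + \<tau>"
    have "(shift_diff \<tau> ^^ n) (D (Suc 0)) x > 0"
      using Suc.IH[of "\<lambda>k. D (Suc k)" x] Suc.prems x by simp
    then show "\<exists>y. ((shift_diff \<tau> ^^ n) (D 0) has_real_derivative y) (at x) \<and> 0 < y"
      using shift_diff_funpow_DERIV[of D \<tau> x n 0] Suc.prems x assms(2) by auto
  qed (use assms(2) in simp)
  then show ?case
    unfolding shift_diff_funpow_Suc by simp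
qed simp

lemma shift_diff_funpow_cmult:
  "(shift_diff v ^^ n) (\<lambda>y. c * f y) = (\<lambda>y. c * (shift_diff v ^^ n) f y)"
  by (induction n) (simp_all add: shift_diff_def fun_eq_iff algebra_simps)

text \<open>The \<open>n\<close>-th derivative of \<open>s powr lam\<close> is a power times the
  product of \<open>lam - i\<close> over \<open>i < n\<close>, which has no zero factor. It has one
  sign on the whole half-line, and the \<open>n\<close>-th difference inherits that sign.\<close>

lemma shift_diff_funpow_powr_nonzero:
  fixes lam \<tau> t :: real
  assumes "lam \<notin> \<nat>" "\<tau> > 0" "t > 0"
  shows "(shift_diff \<tau> ^^ n) (\<lambda>s. s powr lam) t \<noteq> 0"
proof -
  \<comment> \<open>The free factor \<open>c\<close> is later set to the product \<open>P\<close>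
    itself, so that the \<open>n\<close>-th derivative carries \<open>P * P > 0\<close> whatever the
    sign of \<open>P\<close>.\<close>
  define D where "D = (\<lambda>c k s. c * ((\<Prod>i<k. lam - real i) * s powr (lam - real k)))"
  have deriv: "(D c k has_real_derivative D c (Suc k) s) (at s)" if "0 < s" for c k s
  proof -
    have "((\<lambda>s. s powr (lam - real k)) has_real_derivative (lam - real k) * s powr (lam - real k - 1)) (at s)"
      using has_real_derivative_powr[OF that] .
    from DERIV_cmult[OF DERIV_cmult[OF this, of "\<Prod>i<k. lam - real i"], of c]
    show ?thesis
      by (simp add: D_def algebra_simps)
  qed
  define P where "P = (\<Prod>i<n. lam - real i)"
  have "lam \<noteq> real i" for i
    using assms(1) by auto
  then have P: "P \<noteq> 0"
    by (simp add: P_def)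
  have pos: "D P n s > 0" if "0 < s" for s
  proof -
    have "P * P > 0"
      using P not_real_square_gt_zero by blast
    then show ?thesis
      using that by (simp add: D_def P_def[symmetric] mult.assoc[symmetric])
  qed
  have "(shift_diff \<tau> ^^ n) (D P 0) t > 0"
    by (rule shift_diff_funpow_pos[of "D P", OF deriv assms(2) pos assms(3)])
  then show ?thesis
    by (auto simp: D_def shift_diff_funpow_cmult)
qed

text \<open>A class stable under translations and differences whose product with an integrable
  function is integrable; it discharges the integrability conditions below.\<close>

definition bounded_borel :: "('a::topological_space \<Rightarrow> real) \<Rightarrow> bool" where
  "bounded_borel f \<longleftrightarrow> f \<in> borel_measurable borel \<and> (\<exists>B. \<forall>x. \<bar>f x\<bar> \<le> B)"

lemma bounded_borel_shift_diff:
  fixes f :: "'a::euclidean_space \<Rightarrow> real"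
  assumes "bounded_borel f"
  shows "bounded_borel (shift_diff v f)"
proof -
  obtain B where [measurable]: "f \<in> borel_measurable borel" and B: "\<And>x. \<bar>f x\<bar> \<le> B"
    using assms by (auto simp: bounded_borel_def)
  have "\<bar>shift_diff v f x\<bar> \<le> B + B" for x
    using B[of x] B[of "x + v"] unfolding shift_diff_def by linarith
  then show ?thesis
    unfolding bounded_borel_def shift_diff_def by auto
qed

lemma bounded_borel_shift_diff_funpow:
  fixes f :: "'a::euclidean_space \<Rightarrow> real"
  shows "bounded_borel f \<Longrightarrow> bounded_borel ((shift_diff v ^^ n) f)"
  by (induction n) (simp_all add: bounded_borel_shift_diff)

lemma integrable_mult_bounded_borel:
  fixes F f :: "'a::euclidean_space \<Rightarrow> real"
  assumes F: "integrable lborel F" and "bounded_borel f"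
  shows "integrable lborel (\<lambda>x. F x * f x)"
proof -
  obtain B where [measurable]: "f \<in> borel_measurable borel" and B: "\<And>x. \<bar>f x\<bar> \<le> B"
    using assms by (auto simp: bounded_borel_def)
  have [measurable]: "F \<in> borel_measurable borel"
    using F by auto
  show ?thesis
  proof (rule Bochner_Integration.integrable_bound)
    show "integrable lborel (\<lambda>x. B * F x)"
      using F by simp
    show "AE x in lborel. norm (F x * f x) \<le> norm (B * F x)"
    proof (rule AE_I2)
      fix x
      show "norm (F x * f x) \<le> norm (B * F x)"
        using mult_right_mono[OF B[of x], of "\<bar>F x\<bar>"] order_trans[OF abs_ge_zero B[of x]]
        by (simp add: abs_mult mult.commute)
    qed
  qed simp
qed

lemma lborel_translate:
  fixes F :: "'a::euclidean_space \<Rightarrow> real"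
  assumes F: "integrable lborel F"
  shows "integrable lborel (\<lambda>x. F (x + v))" "(LINT x|lborel. F (x + v)) = integral\<^sup>L lborel F"
proof -
  have [measurable]: "F \<in> borel_measurable borel"
    using F by auto
  have "integrable (distr lborel borel ((+) v)) F"
    using F by (simp add: lborel_distr_plus)
  then show "integrable lborel (\<lambda>x. F (x + v))"
    by (subst (asm) integrable_distr_eq) (simp_all add: add.commute)
  have "integral\<^sup>L lborel F = integral\<^sup>L (distr lborel borel ((+) v)) F"
    by (simp add: lborel_distr_plus)
  also have "\<dots> = (LINT x|lborel. F (x + v))"
    by (subst integral_distr) (simp_all add: add.commute)
  finally show "(LINT x|lborel. F (x + v)) = integral\<^sup>L lborel F" by simp
qed

text \<open>Translation invariance of Lebesgue measure. In contrast to integration by parts, the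
  step is reversed instead of the sign.\<close>

lemma shift_diff_adjoint:
  fixes F f :: "'a::euclidean_space \<Rightarrow> real"
  assumes F: "integrable lborel F" and f: "bounded_borel f"
  shows "(LINT x|lborel. F x * shift_diff v f x) = (LINT x|lborel. shift_diff (- v) F x * f x)"
proof -
  have f': "bounded_borel (\<lambda>x. f (x + v))"
    using f by (auto simp: bounded_borel_def)
  have F': "integrable lborel (\<lambda>x. F (x - v))"
    using lborel_translate(1)[OF F, of "- v"] by simp
  have "(LINT x|lborel. F x * shift_diff v f x) = (LINT x|lborel. F x * f (x + v)) - (LINT x|lborel. F x * f x)"
    unfolding shift_diff_def right_diff_distrib
    by (intro Bochner_Integration.integral_diff integrable_mult_bounded_borel F f f')
  also have "(LINT x|lborel. F x * f (x + v)) = (LINT x|lborel. F (x - v) * f x)"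
    using lborel_translate(2)[OF integrable_mult_bounded_borel[OF F f'], of "- v"] by simp
  also have "(LINT x|lborel. F (x - v) * f x) - (LINT x|lborel. F x * f x)
    = (LINT x|lborel. shift_diff (- v) F x * f x)"
    unfolding shift_diff_def left_diff_distrib
    by (subst Bochner_Integration.integral_diff)
       (use integrable_mult_bounded_borel[OF F' f] integrable_mult_bounded_borel[OF F f] in simp_all)
  finally show ?thesis .
qed

lemma shift_diff_funpow_adjoint:
  fixes F f :: "'a::euclidean_space \<Rightarrow> real"
  assumes F: "integrable lborel F" and f: "bounded_borel f"
  shows "(LINT x|lborel. F x * (shift_diff v ^^ n) f x) = (LINT x|lborel. (shift_diff (- v) ^^ n) F x * f x)"
    and "integrable lborel ((shift_diff (- v) ^^ n) F)"
proof -
  have int: "integrable lborel (shift_diff w G)" if "integrable lborel G" for w and G :: "'a \<Rightarrow> real"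
    unfolding shift_diff_def using that lborel_translate(1) by (intro Bochner_Integration.integrable_diff) auto
  show "integrable lborel ((shift_diff (- v) ^^ n) F)"
    using F by (induction n) (simp_all add: int)
  show "(LINT x|lborel. F x * (shift_diff v ^^ n) f x) = (LINT x|lborel. (shift_diff (- v) ^^ n) F x * f x)"
    using F
  proof (induction n arbitrary: F)
    case (Suc n)
    have "(LINT x|lborel. F x * (shift_diff v ^^ Suc n) f x)
      = (LINT x|lborel. shift_diff (- v) F x * (shift_diff v ^^ n) f x)"
      using shift_diff_adjoint[OF Suc.prems bounded_borel_shift_diff_funpow[OF f]] by simp
    also have "\<dots> = (LINT x|lborel. (shift_diff (- v) ^^ n) (shift_diff (- v) F) x * f x)"
      by (rule Suc.IH[OF int[OF Suc.prems]])
    finally show ?case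
      by (simp only: funpow_Suc_right o_apply)
  qed simp
qed

lemma bump_deriv_bounded_borel:
  assumes "bump_deriv n c r f"
  shows "bounded_borel f" "continuous_on UNIV f" "integrable lborel f"
proof -
  obtain D where D: "smooth_family D" "\<And>t. r < \<bar>t - c\<bar> \<Longrightarrow> D 0 t = 0" "D n = f"
    using assms by (auto simp: bump_deriv_def)
  show cont: "continuous_on UNIV f"
    using smooth_family_continuous[OF D(1)] D(3) by blast
  have supp: "f t = 0" if "r < \<bar>t - c\<bar>" for t
    using smooth_family_support[OF D(1,2)] that D(3) by blast
  show "integrable lborel f"
    by (rule integrable_continuous_support[OF cont supp])
  have "bounded (f ` {c - r..c + r})"
    using cont by (intro compact_imp_bounded compact_continuous_image) (auto intro: continuous_on_subset)
  then obtain B where B: "\<forall>x\<in>f ` {c - r..c + r}. norm x \<le> B"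
    unfolding bounded_iff by blast
  have "\<bar>f t\<bar> \<le> \<bar>B\<bar>" for t
    using B supp[of t] by (cases "r < \<bar>t - c\<bar>") (auto simp: abs_real_def split: if_splits)
  then show "bounded_borel f"
    using cont by (auto simp: bounded_borel_def intro: borel_measurable_continuous_onI)
qed

lemma bounded_borel_tensor:
  fixes i j :: "'n::finite"
  assumes "bounded_borel f" "bounded_borel g"
  shows "bounded_borel (\<lambda>x::real^'n. f (x $ i) * g (x $ j))"
proof -
  obtain B C where [measurable]: "f \<in> borel_measurable borel" "g \<in> borel_measurable borel"
    and B: "\<And>x. \<bar>f x\<bar> \<le> B" "\<And>x. \<bar>g x\<bar> \<le> C"
    using assms by (auto simp: bounded_borel_def)
  have "\<bar>f (x $ i) * g (x $ j)\<bar> \<le> B * C" for x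
    unfolding abs_mult using order_trans[OF abs_ge_zero B(1)] by (intro mult_mono B) auto
  then show ?thesis
    unfolding bounded_borel_def by (auto intro!: exI[of _ "B * C"])
qed

text \<open>The Leibniz rule for differences distributes \<open>n\<close> differences in a skew direction over the
  two coordinates.\<close>

lemma tensor_shift_diff_split:
  fixes F :: "real ^ 2 \<Rightarrow> real" and v c :: "real ^ 2"
  assumes F: "integrable lborel F" and v: "\<bar>v $ 1\<bar> \<le> \<tau>" "\<bar>v $ 2\<bar> \<le> \<tau>"
    and "bump_deriv a (c $ 1) r f" "bump_deriv b (c $ 2) r g"
    and "(LINT x|lborel. F x * (shift_diff v ^^ n) (\<lambda>x. f (x $ 1) * g (x $ 2)) x) \<noteq> 0"
  shows "\<exists>a' b' f' g'. bump_deriv a' (c $ 1) (r + real n * \<tau>) f' \<and>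
    bump_deriv b' (c $ 2) (r + real n * \<tau>) g' \<and> a' + b' = a + b + n \<and>
    (LINT x|lborel. F x * (f' (x $ 1) * g' (x $ 2))) \<noteq> 0"
  using assms(4-6)
proof (induction n arbitrary: a b r f g)
  case 0
  then show ?case by auto
next
  case (Suc n)
  let ?f1 = "shift_diff (v $ 1) f" and ?g1 = "\<lambda>t. g (t + v $ 2)" and ?g2 = "shift_diff (v $ 2) g"
  have f1: "bump_deriv (Suc a) (c $ 1) (r + \<tau>) ?f1"
    unfolding shift_diff_def using Suc.prems(1) v by (intro bump_deriv_difference) auto
  \<comment> \<open>Translation by zero merely enlarges the radius, so that all four factors share
    \<open>r + \<tau>\<close>.\<close>
  have f0: "bump_deriv a (c $ 1) (r + \<tau>) f"
    using bump_deriv_translate[OF Suc.prems(1), of 0] v(1) by auto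
  have g1: "bump_deriv b (c $ 2) (r + \<tau>) ?g1"
    using Suc.prems(2) v by (intro bump_deriv_translate) auto
  have g2: "bump_deriv (Suc b) (c $ 2) (r + \<tau>) ?g2"
    unfolding shift_diff_def using Suc.prems(2) v by (intro bump_deriv_difference) auto
  let ?I = "\<lambda>f g. LINT x|lborel. F x * (shift_diff v ^^ n) (\<lambda>x. f (x $ 1) * g (x $ 2)) x"
  have int: "integrable lborel (\<lambda>x. F x * (shift_diff v ^^ n) (\<lambda>x. p (x $ 1) * q (x $ 2)) x)"
    if "bounded_borel p" "bounded_borel q" for p q
    using that by (intro integrable_mult_bounded_borel[OF F] bounded_borel_shift_diff_funpow bounded_borel_tensor)
  have "shift_diff v (\<lambda>x. f (x $ 1) * g (x $ 2)) =
      (\<lambda>x. ?f1 (x $ 1) * ?g1 (x $ 2) + f (x $ 1) * ?g2 (x $ 2))"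
    by (simp add: shift_diff_def fun_eq_iff algebra_simps)
  then have "(LINT x|lborel. F x * (shift_diff v ^^ Suc n) (\<lambda>x. f (x $ 1) * g (x $ 2)) x) =
    (LINT x|lborel. F x * (shift_diff v ^^ n) (\<lambda>x. ?f1 (x $ 1) * ?g1 (x $ 2)) x
       + F x * (shift_diff v ^^ n) (\<lambda>x. f (x $ 1) * ?g2 (x $ 2)) x)"
    by (simp only: funpow_Suc_right o_apply shift_diff_funpow_add distrib_left)
  also have "\<dots> = ?I ?f1 ?g1 + ?I f ?g2"
    using f1 f0 g1 g2 by (intro Bochner_Integration.integral_add int bump_deriv_bounded_borel(1))
  \<comment> \<open>Of the two summands at least one has a nonzero pairing, and the induction
    continues with that one.\<close>
  finally consider "?I ?f1 ?g1 \<noteq> 0" | "?I f ?g2 \<noteq> 0"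
    using Suc.prems(3) by force
  then show ?case
  proof cases
    case 1
    from Suc.IH[OF f1 g1 this] show ?thesis
      by (auto simp: algebra_simps)
  next
    case 2
    from Suc.IH[OF f0 g2 this] show ?thesis
      by (auto simp: algebra_simps)
  qed
qed

subsection \<open>A product test function that detects the singular function\<close>

lemma bump_integral_pos:
  assumes D: "smooth_family D" "\<And>t. D 0 t \<ge> 0" "\<And>t. \<delta> < \<bar>t - c\<bar> \<Longrightarrow> D 0 t = 0" "D 0 c > 0"
  shows "integral\<^sup>L lborel (D 0) > 0"
proof -
  have "isCont (D 0) c"
    using smooth_familyD[OF D(1)] DERIV_isCont by blast
  then obtain \<eta> where \<eta>: "\<eta> > 0" "\<And>t. dist t c < \<eta> \<Longrightarrow> dist (D 0 t) (D 0 c) < D 0 c / 2"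
    using D(4) unfolding continuous_at_eps_delta by (metis half_gt_zero)
  have int: "integrable lborel (D 0)"
    by (rule integrable_continuous_support[OF smooth_family_continuous[OF D(1)] D(3)])
  have "0 < (D 0 c / 2) * \<eta>"
    using D(4) \<eta>(1) by simp
  also have "\<dots> = (LINT t|lborel. D 0 c / 2 * indicator {c - \<eta>/2..c + \<eta>/2} t)"
    using \<eta>(1) by simp
  also have "\<dots> \<le> integral\<^sup>L lborel (D 0)"
  proof (rule Bochner_Integration.integral_mono[OF _ int])
    show "integrable lborel (\<lambda>t. D 0 c / 2 * indicator {c - \<eta>/2..c + \<eta>/2} t)"
      by (intro integrable_mult_right) (simp add: integrable_indicator_iff emeasure_lborel_Icc_eq)
    fix t
    show "D 0 c / 2 * indicator {c - \<eta>/2..c + \<eta>/2} t \<le> D 0 t"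
    proof (cases "t \<in> {c - \<eta>/2..c + \<eta>/2}")
      case True
      then have "dist t c < \<eta>"
        using \<eta>(1) by (simp add: dist_real_def abs_real_def)
      then show ?thesis
        using \<eta>(2)[of t] True by (simp add: dist_real_def abs_real_def split: if_splits)
    qed (use D(2) in simp)
  qed
  finally show ?thesis .
qed

text \<open>A closed square in the maximum norm, since product functions are supported in boxes;
  \<open>\<kappa>\<close> is half the side length.\<close>

definition cube :: "real ^ 2 \<Rightarrow> real \<Rightarrow> (real ^ 2) set" where
  "cube c \<kappa> = {y. \<forall>k. \<bar>y $ k - c $ k\<bar> \<le> \<kappa>}"

lemma cube_eq_cbox: "cube c \<kappa> = cbox (\<chi> k. c $ k - \<kappa>) (\<chi> k. c $ k + \<kappa>)"
  by (auto simp: cube_def mem_box_cart abs_le_iff algebra_simps)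

lemma cube_norm_le:
  assumes "y \<in> cube c \<kappa>"
  shows "norm (y - c) \<le> 2 * \<kappa>"
proof -
  have "norm (y - c) \<le> (\<Sum>k\<in>UNIV. \<bar>(y - c) $ k\<bar>)"
    by (rule norm_le_l1_cart)
  also have "\<dots> \<le> 2 * \<kappa>"
    using assms by (simp add: cube_def UNIV_2 forall_2)
  finally show ?thesis .
qed

text \<open>A high difference \<open>H\<close> of the cut-off \<open>F'\<close> along the ray is
  nonzero at \<open>c\<close>, hence so is its pairing with a narrow product bump. Moving the
  differences onto the bump and splitting them over the coordinates leaves one product whose pairing
  is nonzero.\<close>

lemma tensor_nonvanishing:
  fixes F :: "real ^ 2 \<Rightarrow> real" and e :: "real ^ 2"
  assumes U: "open U" "continuous_on U F" and e: "norm e = 1" and t0: "t0 > 0" "t0 *\<^sub>R e \<in> U"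
    and ray: "\<And>t. t > 0 \<Longrightarrow> F (t *\<^sub>R e) = C * t powr lam" and C: "C \<noteq> 0" and lam: "lam \<notin> \<nat>"
  obtains i j :: 2 and D G :: "nat \<Rightarrow> real \<Rightarrow> real" and c \<kappa> where
    "i \<noteq> j" "smooth_family D" "smooth_family G" "\<kappa> > 0" "cube c \<kappa> \<subseteq> U"
    "\<And>t. \<kappa> < \<bar>t - c $ i\<bar> \<Longrightarrow> D 0 t = 0" "\<And>t. \<kappa> < \<bar>t - c $ j\<bar> \<Longrightarrow> G 0 t = 0"
    "(LINT y|lborel. indicator (cube c \<kappa>) y * F y * (D M (y $ i) * G 0 (y $ j))) \<noteq> 0"
proof -
  define c where "c = t0 *\<^sub>R e"
  obtain \<epsilon> where \<epsilon>: "\<epsilon> > 0" "ball c \<epsilon> \<subseteq> U"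
    using U(1) t0(2) open_contains_ball c_def by blast
  \<comment> \<open>A third of the radius, since a point of the cube may be as far as
    \<open>2 * \<kappa>\<close> from \<open>c\<close> by the estimate used.\<close>
  define \<kappa> where "\<kappa> = \<epsilon> / 3"
  have \<kappa>: "\<kappa> > 0"
    using \<epsilon>(1) by (simp add: \<kappa>_def)
  have cube_U: "cube c \<kappa> \<subseteq> U"
  proof
    fix y assume "y \<in> cube c \<kappa>"
    from cube_norm_le[OF this] have "y \<in> ball c \<epsilon>"
      using \<epsilon>(1) by (simp add: \<kappa>_def dist_norm norm_minus_commute)
    then show "y \<in> U" using \<epsilon>(2) by blast
  qed
  define F' where "F' = (\<lambda>y. indicator (cube c \<kappa>) y * F y)"
  have F'_int: "integrable lborel F'"
  proof -
    have "integrable lborel (\<lambda>y. indicator (cube c \<kappa>) y *\<^sub>R F y)"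
      using U(2) cube_U by (intro borel_integrable_compact) (auto simp: cube_eq_cbox intro: continuous_on_subset)
    then show ?thesis by (simp add: F'_def)
  qed
  \<comment> \<open>From \<open>a + b = 2 * M + 1\<close> it follows that one of the two orders is
    at least \<open>M\<close>.\<close>
  define N where "N = 2 * M + 1"
  \<comment> \<open>All \<open>N\<close> steps together use up half of \<open>\<kappa>\<close>; the
    other half is left for the support of the bump.\<close>
  define \<tau> where "\<tau> = \<kappa> / (2 * real N)"
  have \<tau>: "\<tau> > 0" "real N * \<tau> = \<kappa> / 2"
  proof -
    have "real N > 0" by (simp add: N_def)
    then show "\<tau> > 0" "real N * \<tau> = \<kappa> / 2"
      using \<kappa> by (simp_all add: \<tau>_def)
  qed
  have e_comp: "\<bar>e $ k\<bar> \<le> 1" for k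
    using component_le_norm_cart[of e k] e by simp
  have on_ray: "F' ((t0 + real j * \<tau>) *\<^sub>R e) = C * (t0 + real j * \<tau>) powr lam"
    and cont_ray: "isCont F' ((t0 + real j * \<tau>) *\<^sub>R e)" if j: "j \<le> N" for j
  proof -
    let ?y = "(t0 + real j * \<tau>) *\<^sub>R e"
    have jt: "0 \<le> real j * \<tau>" "real j * \<tau> \<le> \<kappa> / 2"
      using j \<tau> mult_right_mono[of "real j" "real N" \<tau>] by auto
    have near: "\<bar>?y $ k - c $ k\<bar> \<le> \<kappa> / 2" for k
    proof -
      have "\<bar>?y $ k - c $ k\<bar> = real j * \<tau> * \<bar>e $ k\<bar>"
        using \<tau>(1) by (simp add: c_def algebra_simps abs_mult)
      also have "\<dots> \<le> real j * \<tau> * 1"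
        using jt(1) e_comp by (intro mult_left_mono) auto
      finally show ?thesis using jt(2) by simp
    qed
    \<comment> \<open>An open set inside the cube that contains the node; \<open>F'\<close> agrees
      with \<open>F\<close> on it and so inherits continuity.\<close>
    let ?V = "{y::real^2. \<bar>y $ 1 - c $ 1\<bar> < \<kappa>} \<inter> {y. \<bar>y $ 2 - c $ 2\<bar> < \<kappa>}"
    have V: "open ?V"
      by (intro open_Int open_Collect_less continuous_intros)
    have yV: "?y \<in> ?V"
      using near[of 1] near[of 2] \<kappa> by auto
    have V_cube: "y \<in> cube c \<kappa>" if "y \<in> ?V" for y
      using that by (auto simp: cube_def forall_2)
    have "0 < t0 + real j * \<tau>"
      using t0(1) jt(1) by linarith
    then show "F' ?y = C * (t0 + real j * \<tau>) powr lam"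
      using V_cube[OF yV] ray by (simp add: F'_def)
    have "isCont F ?y"
      using U V_cube[OF yV] cube_U continuous_on_eq_continuous_at by blast
    moreover have "\<forall>\<^sub>F y in nhds ?y. F' y = F y"
      by (rule eventually_mono[OF eventually_nhds_in_open[OF V yV]]) (use V_cube in \<open>simp add: F'_def\<close>)
    ultimately show "isCont F' ?y"
      using isCont_cong by blast
  qed
  define H where "H = (shift_diff (\<tau> *\<^sub>R e) ^^ N) F'"
  have "H c = (shift_diff \<tau> ^^ N) (\<lambda>s. F' (s *\<^sub>R e)) t0"
    by (simp add: H_def c_def shift_diff_funpow_line)
  also have "\<dots> = (shift_diff \<tau> ^^ N) (\<lambda>s. C * s powr lam) t0"
    by (rule shift_diff_funpow_cong) (use on_ray in simp)
  finally have Hc: "H c \<noteq> 0"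
    using shift_diff_funpow_powr_nonzero[OF lam \<tau>(1) t0(1), of N] C
    by (simp add: shift_diff_funpow_cmult)
  have "isCont H c"
    unfolding H_def
  proof (rule isCont_shift_diff_funpow)
    fix j assume "j \<le> N"
    then show "isCont F' (c + real j *\<^sub>R \<tau> *\<^sub>R e)"
      using cont_ray[of j] by (simp add: c_def scaleR_left_distrib)
  qed
  then obtain \<delta>0 where \<delta>0: "\<delta>0 > 0" "\<And>y. dist y c < \<delta>0 \<Longrightarrow> dist (H y) (H c) < \<bar>H c\<bar> / 2"
    using Hc unfolding continuous_at_eps_delta by (metis half_gt_zero zero_less_abs_iff)
  define \<delta> where "\<delta> = min (\<kappa> / 2) (\<delta>0 / 3)"
  have \<delta>: "\<delta> > 0" "\<delta> \<le> \<kappa> / 2" "2 * \<delta> < \<delta>0"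
    using \<kappa> \<delta>0(1) by (auto simp: \<delta>_def)
  obtain D1 where D1: "smooth_family D1" "\<And>t. D1 0 t \<ge> 0" "\<And>t. \<delta> < \<bar>t - c $ 1\<bar> \<Longrightarrow> D1 0 t = 0" "D1 0 (c $ 1) > 0"
    using smooth_bump[OF \<delta>(1)] by metis
  obtain D2 where D2: "smooth_family D2" "\<And>t. D2 0 t \<ge> 0" "\<And>t. \<delta> < \<bar>t - c $ 2\<bar> \<Longrightarrow> D2 0 t = 0" "D2 0 (c $ 2) > 0"
    using smooth_bump[OF \<delta>(1)] by metis
  have bump1: "bump_deriv 0 (c $ 1) \<delta> (D1 0)" and bump2: "bump_deriv 0 (c $ 2) \<delta> (D2 0)"
    using D1 D2 unfolding bump_deriv_def by blast+
  let ?\<beta> = "\<lambda>y::real^2. D1 0 (y $ 1) * D2 0 (y $ 2)"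
  have \<beta>_bb: "bounded_borel ?\<beta>"
    using bump1 bump2 by (intro bounded_borel_tensor bump_deriv_bounded_borel(1))
  have ne12: "(1::2) \<noteq> 2" by simp
  have \<beta>_int: "integrable lborel ?\<beta>"
    by (rule integral_tensor(2)[OF ne12]) (use bump1 bump2 bump_deriv_bounded_borel(3) in blast)+
  have \<beta>_pos: "(LINT y|lborel. ?\<beta> y) > 0"
    using bump_integral_pos[OF D1] bump_integral_pos[OF D2]
    by (subst integral_tensor(1)[OF ne12]) (use bump1 bump2 bump_deriv_bounded_borel(3) in auto)
  have "integrable lborel H"
    unfolding H_def using shift_diff_funpow_adjoint(2)[OF F'_int \<beta>_bb, where v = "- (\<tau> *\<^sub>R e)" and n = N] by simp
  then have H\<beta>: "integrable lborel (\<lambda>y. H y * ?\<beta> y)"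
    using \<beta>_bb by (rule integrable_mult_bounded_borel)
  \<comment> \<open>Multiplying by \<open>H c\<close> makes the argument independent of its sign: on
    the support of the bump, \<open>H c * H y\<close> is at least half of the square of
    \<open>H c\<close>.\<close>
  have "0 < (H c)\<^sup>2 / 2 * (LINT y|lborel. ?\<beta> y)"
    using Hc \<beta>_pos by simp
  also have "\<dots> = (LINT y|lborel. (H c)\<^sup>2 / 2 * ?\<beta> y)"
    by simp
  also have "\<dots> \<le> (LINT y|lborel. H c * (H y * ?\<beta> y))"
  proof (intro Bochner_Integration.integral_mono integrable_mult_right H\<beta> \<beta>_int)
    fix y
    show "(H c)\<^sup>2 / 2 * ?\<beta> y \<le> H c * (H y * ?\<beta> y)"
    proof (cases "?\<beta> y = 0")
      case True
      then show ?thesis by (simp only: mult_zero_right order_refl)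
    next
      case False
      then have "\<bar>y $ 1 - c $ 1\<bar> \<le> \<delta>" "\<bar>y $ 2 - c $ 2\<bar> \<le> \<delta>"
        using D1(3)[of "y $ 1"] D2(3)[of "y $ 2"] by fastforce+
      then have "y \<in> cube c \<delta>"
        by (simp add: cube_def forall_2)
      from cube_norm_le[OF this] have "\<bar>H y - H c\<bar> < \<bar>H c\<bar> / 2"
        using \<delta>0(2)[of y] \<delta>(3) by (simp add: dist_norm)
      then have "\<bar>H c\<bar> * \<bar>H y - H c\<bar> \<le> \<bar>H c\<bar> * (\<bar>H c\<bar> / 2)"
        by (intro mult_left_mono) auto
      then have "\<bar>H c * (H y - H c)\<bar> \<le> (H c)\<^sup>2 / 2"
        by (simp add: abs_mult power2_eq_square)
      then have "(H c)\<^sup>2 / 2 \<le> H c * H y"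
        unfolding power2_eq_square right_diff_distrib abs_le_iff by linarith
      then show ?thesis
        using D1(2) D2(2) mult_right_mono[of "(H c)\<^sup>2 / 2" "H c * H y" "?\<beta> y"] by (simp add: mult.assoc)
    qed
  qed
  also have "\<dots> = H c * (LINT y|lborel. H y * ?\<beta> y)"
    by simp
  finally have "(LINT y|lborel. H y * ?\<beta> y) \<noteq> 0"
    by auto
  then have "(LINT y|lborel. F' y * (shift_diff (- (\<tau> *\<^sub>R e)) ^^ N) ?\<beta> y) \<noteq> 0"
    using shift_diff_funpow_adjoint(1)[OF F'_int \<beta>_bb, where v = "- (\<tau> *\<^sub>R e)" and n = N] by (simp add: H_def)
  moreover have "\<bar>(- (\<tau> *\<^sub>R e)) $ k\<bar> \<le> \<tau>" for k
    using e_comp[of k] \<tau>(1) by (simp add: abs_mult mult_left_le)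
  ultimately obtain a b f g where
    ab: "bump_deriv a (c $ 1) (\<delta> + real N * \<tau>) f" "bump_deriv b (c $ 2) (\<delta> + real N * \<tau>) g" "a + b = N"
    and fg: "(LINT y|lborel. F' y * (f (y $ 1) * g (y $ 2))) \<noteq> 0"
    using tensor_shift_diff_split[OF F'_int _ _ bump1 bump2, where v = "- (\<tau> *\<^sub>R e)" and \<tau> = \<tau> and n = N] by auto
  have r: "\<delta> + real N * \<tau> \<le> \<kappa>"
    using \<tau>(2) \<delta>(2) by linarith
  obtain A where A: "smooth_family A" "\<And>t. \<delta> + real N * \<tau> < \<bar>t - c $ 1\<bar> \<Longrightarrow> A 0 t = 0" "A a = f"
    using ab(1) by (auto simp: bump_deriv_def)
  obtain B where B: "smooth_family B" "\<And>t. \<delta> + real N * \<tau> < \<bar>t - c $ 2\<bar> \<Longrightarrow> B 0 t = 0" "B b = g"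
    using ab(2) by (auto simp: bump_deriv_def)
  have A0: "A k t = 0" if "\<kappa> < \<bar>t - c $ 1\<bar>" for k t
    using smooth_family_support[OF A(1,2)] that r by auto
  have B0: "B k t = 0" if "\<kappa> < \<bar>t - c $ 2\<bar>" for k t
    using smooth_family_support[OF B(1,2)] that r by auto
  have AB: "(LINT y|lborel. F' y * (A a (y $ 1) * B b (y $ 2))) \<noteq> 0"
    using fg A(3) B(3) by simp
  note facts = smooth_family_shift[OF A(1)] smooth_family_shift[OF B(1)] A0 B0 \<kappa> cube_U
  show ?thesis
  proof (cases "a \<ge> M")
    case True
    \<comment> \<open>Surplus derivatives are absorbed by shifting the index of the family, so that
      its \<open>M\<close>-th member is \<open>A a\<close>.\<close>
    then obtain n where "a = n + M"
      using le_Suc_ex add.commute by metis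
    then show ?thesis
      using AB facts by (intro that[of 1 2 "\<lambda>k. A (n + k)" "\<lambda>k. B (b + k)" \<kappa> c]) (simp_all add: F'_def)
  next
    case False
    then have "b \<ge> M"
      using ab(3) by (simp add: N_def)
    \<comment> \<open>Now the second coordinate carries the \<open>M\<close> derivatives, so the
      roles of \<open>i\<close> and \<open>j\<close> are exchanged.\<close>
    then obtain n where "b = n + M"
      using le_Suc_ex add.commute by metis
    then show ?thesis
      using AB facts by (intro that[of 2 1 "\<lambda>k. B (n + k)" "\<lambda>k. A (a + k)" \<kappa> c])
        (simp_all add: F'_def mult.commute[of "B _ _"])
  qed
qed

subsection \<open>Corner and mesh geometry\<close>

text \<open>Near the ray of direction \<open>\<theta>0\<close> the polar angle is \<open>\<theta>0 + arctan (s / t)\<close> where \<open>t\<close> and \<open>s\<close>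
  are the coordinates along and across the ray.\<close>

lemma sector_chart:
  fixes \<alpha> \<omega> \<theta>0 :: real
  assumes \<theta>0: "\<alpha> < \<theta>0" "\<theta>0 < \<alpha> + \<omega>"
  obtains V and ang :: "real ^ 2 \<Rightarrow> real" where
    "open V" "continuous_on V ang"
    "\<And>t. t > 0 \<Longrightarrow> t *\<^sub>R vector [cos \<theta>0, sin \<theta>0] \<in> V \<and> ang (t *\<^sub>R vector [cos \<theta>0, sin \<theta>0]) = \<theta>0"
    "\<And>h y. h > 0 \<Longrightarrow> ang (h *\<^sub>R y) = ang y"
    "\<And>y. y \<in> V \<Longrightarrow> y \<noteq> 0 \<and> \<alpha> < ang y \<and> ang y < \<alpha> + \<omega>"
    "\<And>x0 y. y \<in> V \<Longrightarrow> polar x0 (norm y) (ang y) = x0 + y"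
proof -
  \<comment> \<open>Small enough for the cone of half-angle \<open>\<eta>\<close> to stay inside the
    sector, and below \<open>pi / 2\<close> so that \<open>tan \<eta>\<close> is positive.\<close>
  define \<eta> where "\<eta> = min (min (\<theta>0 - \<alpha>) (\<alpha> + \<omega> - \<theta>0)) 1"
  have \<eta>: "0 < \<eta>" "\<eta> < pi / 2" "\<eta> \<le> \<theta>0 - \<alpha>" "\<eta> \<le> \<alpha> + \<omega> - \<theta>0"
  proof -
    have "\<eta> \<le> 1" by (simp add: \<eta>_def)
    then show "\<eta> < pi / 2" using pi_gt3 by linarith
  qed (use \<theta>0 in \<open>auto simp: \<eta>_def\<close>)
  have tan\<eta>: "tan \<eta> > 0"
    using \<eta> by (intro tan_gt_zero) auto
  define t where "t = (\<lambda>y::real^2. y $ 1 * cos \<theta>0 + y $ 2 * sin \<theta>0)"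
  define s where "s = (\<lambda>y::real^2. y $ 2 * cos \<theta>0 - y $ 1 * sin \<theta>0)"
  define ang where "ang = (\<lambda>y. \<theta>0 + arctan (s y / t y))"
  \<comment> \<open>Stated without division, this forces \<open>t y > 0\<close> and bounds
    \<open>s y / t y\<close> by the tangent of \<open>\<eta>\<close>.\<close>
  define V where "V = {y. \<bar>s y\<bar> < tan \<eta> * t y}"
  have cont: "continuous_on A t" "continuous_on A s" for A
    unfolding t_def s_def by (intro continuous_intros)+
  have tpos: "t y > 0" if "y \<in> V" for y
  proof -
    have "0 < tan \<eta> * t y"
      using that unfolding V_def by (auto intro: le_less_trans[OF abs_ge_zero])
    then show ?thesis using tan\<eta> by (simp add: zero_less_mult_iff)
  qed
  show ?thesis
  proof (rule that[of V ang])
    show "open V"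
      unfolding V_def by (intro open_Collect_less continuous_intros cont)
    show "continuous_on V ang"
      unfolding ang_def by (intro continuous_intros cont) (use tpos in fastforce)
    show "r *\<^sub>R vector [cos \<theta>0, sin \<theta>0] \<in> V \<and> ang (r *\<^sub>R vector [cos \<theta>0, sin \<theta>0]) = \<theta>0"
      if "r > 0" for r
    proof -
      have "t (r *\<^sub>R vector [cos \<theta>0, sin \<theta>0]) = r * (cos \<theta>0 * cos \<theta>0 + sin \<theta>0 * sin \<theta>0)"
        unfolding distrib_left by (simp add: t_def)
      then have "t (r *\<^sub>R vector [cos \<theta>0, sin \<theta>0]) = r"
        by simp
      moreover have "s (r *\<^sub>R vector [cos \<theta>0, sin \<theta>0]) = 0"
        by (simp add: s_def)
      ultimately show ?thesis
        using that tan\<eta> by (simp add: V_def ang_def)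
    qed
    show "ang (h *\<^sub>R y) = ang y" if "h > 0" for h y
    proof -
      have "t (h *\<^sub>R y) = h * t y" "s (h *\<^sub>R y) = h * s y"
        by (simp_all add: t_def s_def algebra_simps)
      then show ?thesis
        using that by (simp add: ang_def)
    qed
    show "y \<noteq> 0 \<and> \<alpha> < ang y \<and> ang y < \<alpha> + \<omega>" if y: "y \<in> V" for y
    proof -
      have "\<bar>s y / t y\<bar> < tan \<eta>"
        using y tpos[OF y] by (simp add: V_def abs_divide pos_divide_less_eq)
      then have "s y / t y < tan \<eta>" "- tan \<eta> < s y / t y"
        unfolding abs_less_iff by linarith+
      then have "arctan (s y / t y) < arctan (tan \<eta>)" "arctan (- tan \<eta>) < arctan (s y / t y)"
        unfolding arctan_less_iff .
      then have "arctan (s y / t y) < \<eta>" "- \<eta> < arctan (s y / t y)"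
        using \<eta> by (simp_all add: arctan_tan arctan_minus)
      moreover have "y \<noteq> 0"
        using tpos[OF y] by (auto simp: t_def)
      ultimately show ?thesis
        using \<eta> by (auto simp: ang_def)
    qed
    show "polar x0 (norm y) (ang y) = x0 + y" if y: "y \<in> V" for x0 y
    proof -
      note pos = tpos[OF y]
      \<comment> \<open>\<open>q\<close> is the secant of the angle off the ray: the norm is
        \<open>t y * q\<close>, and \<open>cos\<close> and \<open>sin\<close> of the arctangent have
        denominator \<open>q\<close>.\<close>
      define q where "q = sqrt (1 + (s y / t y)\<^sup>2)"
      have q: "q > 0"
        by (simp add: q_def add_pos_nonneg)
      have cs: "(cos \<theta>0)\<^sup>2 + (sin \<theta>0)\<^sup>2 = 1"
        by simp
      have "(t y)\<^sup>2 + (s y)\<^sup>2 = ((y $ 1)\<^sup>2 + (y $ 2)\<^sup>2) * ((cos \<theta>0)\<^sup>2 + (sin \<theta>0)\<^sup>2)"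
        unfolding t_def s_def by algebra
      then have ts: "(y $ 1)\<^sup>2 + (y $ 2)\<^sup>2 = (t y)\<^sup>2 + (s y)\<^sup>2"
        by simp
      have "norm y = sqrt ((y $ 1)\<^sup>2 + (y $ 2)\<^sup>2)"
        by (simp add: norm_vec_def L2_set_def sum_2)
      also have "\<dots> = sqrt ((t y)\<^sup>2 * (1 + (s y / t y)\<^sup>2))"
        using pos unfolding ts by (simp add: field_simps)
      also have "\<dots> = t y * q"
        using pos by (simp add: q_def real_sqrt_mult)
      finally have ny: "norm y = t y * q" .
      have c: "norm y * cos (arctan (s y / t y)) = t y" and s: "norm y * sin (arctan (s y / t y)) = s y"
        using pos q unfolding cos_arctan sin_arctan q_def[symmetric] ny by simp_all
      have "norm y * cos (ang y) = norm y * cos (arctan (s y / t y)) * cos \<theta>0 - norm y * sin (arctan (s y / t y)) * sin \<theta>0"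
        by (simp add: ang_def cos_add algebra_simps)
      also have "\<dots> = t y * cos \<theta>0 - s y * sin \<theta>0"
        by (simp only: c s)
      also have "\<dots> = y $ 1 * ((cos \<theta>0)\<^sup>2 + (sin \<theta>0)\<^sup>2)"
        unfolding t_def s_def by algebra
      finally have y1: "norm y * cos (ang y) = y $ 1" by simp
      have "norm y * sin (ang y) = norm y * cos (arctan (s y / t y)) * sin \<theta>0 + norm y * sin (arctan (s y / t y)) * cos \<theta>0"
        by (simp add: ang_def sin_add algebra_simps)
      also have "\<dots> = t y * sin \<theta>0 + s y * cos \<theta>0"
        by (simp only: c s)
      also have "\<dots> = y $ 2 * ((cos \<theta>0)\<^sup>2 + (sin \<theta>0)\<^sup>2)"
        unfolding t_def s_def by algebra
      finally have y2: "norm y * sin (ang y) = y $ 2" by simp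
      show ?thesis
        using y1 y2 by (simp add: polar_def vec_eq_iff forall_2)
    qed
  qed
qed

lemma measure_cube:
  assumes "\<kappa> \<ge> 0"
  shows "measure lebesgue (cube c \<kappa>) = 4 * \<kappa>\<^sup>2" "cube c \<kappa> \<in> lmeasurable"
proof -
  have "c $ k - \<kappa> \<le> c $ k + \<kappa>" for k using assms by simp
  then have "cbox (\<chi> k. c $ k - \<kappa>) (\<chi> k. c $ k + \<kappa>) \<noteq> {}"
    by (simp add: interval_ne_empty_cart)
  then show "measure lebesgue (cube c \<kappa>) = 4 * \<kappa>\<^sup>2"
    unfolding cube_eq_cbox by (simp add: content_cbox_cart power2_eq_square prod_2)
  show "cube c \<kappa> \<in> lmeasurable"
    by (simp add: cube_eq_cbox)
qed

text \<open>The factor is the Jacobian determinant of a dilation of the plane.\<close>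

lemma lborel_integral_rescale:
  fixes f :: "real ^ 2 \<Rightarrow> real"
  assumes f: "integrable lborel f" and h: "h > 0"
  shows "integrable lborel (\<lambda>x. f ((1 / h) *\<^sub>R (x - x0)))"
    and "(LINT x|lborel. f ((1 / h) *\<^sub>R (x - x0))) = h\<^sup>2 * integral\<^sup>L lborel f"
proof -
  have [measurable]: "f \<in> borel_measurable borel"
    using f by auto
  have eq: "lborel = density (distr lborel borel (\<lambda>x. x0 + h *\<^sub>R x)) (\<lambda>_. ennreal (h\<^sup>2))"
    using lborel_affine[of h x0] h by (simp add: ennreal_power)
  have inv: "(1 / h) *\<^sub>R (x0 + h *\<^sub>R x - x0) = x" for x
    using h by simp
  show "integrable lborel (\<lambda>x. f ((1 / h) *\<^sub>R (x - x0)))"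
    by (subst eq, subst integrable_density)
       (use f h in \<open>simp_all add: integrable_distr_eq inv\<close>)
  show "(LINT x|lborel. f ((1 / h) *\<^sub>R (x - x0))) = h\<^sup>2 * integral\<^sup>L lborel f"
    by (subst eq, subst integral_density) (use h in \<open>simp_all add: integral_distr inv\<close>)
qed

text \<open>Each monomial splits into a product of one-dimensional integrals, and the moment in
  coordinate \<open>i\<close> vanishes. Only the degree in that coordinate counts, so a total degree
  up to \<open>2 * p\<close> does no harm.\<close>

lemma tensor_moment_eq_0:
  fixes i j :: 2
  assumes ij: "i \<noteq> j" and D: "smooth_family D" "\<And>t. r < \<bar>t - a\<bar> \<Longrightarrow> D 0 t = 0"
    and G: "smooth_family G" "\<And>t. r < \<bar>t - b\<bar> \<Longrightarrow> G 0 t = 0"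
    and q: "q = (\<lambda>x::real^2. \<Sum>k\<le>p. \<Sum>l\<le>p. \<gamma> k l * (x $ 1) ^ k * (x $ 2) ^ l)" and n: "p < n"
  shows "integrable lborel (\<lambda>x. q x * (D n (x $ i) * G 0 (x $ j)))"
    "(LINT x|lborel. q x * (D n (x $ i) * G 0 (x $ j))) = 0"
proof -
  note suppD = smooth_family_support[OF D] and suppG = smooth_family_support[OF G]
  have intD: "integrable lborel (\<lambda>t. t ^ k * D n t)" for k
    by (rule integrable_continuous_support[where r = r and c = a])
       (use suppD in \<open>auto intro!: continuous_intros smooth_family_continuous[OF D(1)]\<close>)
  have intG: "integrable lborel (\<lambda>t. t ^ k * G 0 t)" for k
    by (rule integrable_continuous_support[where r = r and c = b])
       (use suppG in \<open>auto intro!: continuous_intros smooth_family_continuous[OF G(1)]\<close>)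
  define P where "P = (\<lambda>k l x. (x $ i) ^ k * D n (x $ i) * ((x $ j) ^ l * G 0 (x $ j)))"
  have P_int: "integrable lborel (P k l)" for k l
    unfolding P_def by (rule integral_tensor(2)[OF ij intD intG])
  have P_0: "integral\<^sup>L lborel (P k l) = 0" if "k \<le> p" for k l
  proof -
    have "(LINT t|lborel. t ^ k * D n t) = 0"
      by (rule smooth_family_moment_eq_0[OF D]) (use that n in simp_all)
    then show ?thesis
      unfolding P_def by (simp add: integral_tensor(1)[OF ij intD intG])
  qed
  have "\<exists>\<gamma>'. \<forall>x. q x * (D n (x $ i) * G 0 (x $ j)) = (\<Sum>k\<le>p. \<Sum>l\<le>p. \<gamma>' k l * P k l x)"
  proof (cases "i = 1")
    case True
    then have "j = 2" using ij exhaust_2[of j] by auto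
    then show ?thesis
      using True by (intro exI[of _ \<gamma>]) (simp add: q P_def sum_distrib_left sum_distrib_right mult_ac)
  next
    case False
    then have i: "i = 2" using exhaust_2[of i] by auto
    then have j: "j = 1" using ij exhaust_2[of j] by auto
    \<comment> \<open>With \<open>i = 2\<close> the exponents trade places, so the coefficients are
      transposed.\<close>
    have "q x * (D n (x $ 2) * G 0 (x $ 1)) = (\<Sum>k\<le>p. \<Sum>l\<le>p. \<gamma> l k * P k l x)" for x
    proof -
      have "q x * (D n (x $ 2) * G 0 (x $ 1)) = (\<Sum>k\<le>p. \<Sum>l\<le>p. \<gamma> k l * P l k x)"
        by (simp add: q P_def i j sum_distrib_left sum_distrib_right mult_ac)
      also have "\<dots> = (\<Sum>l\<le>p. \<Sum>k\<le>p. \<gamma> k l * P l k x)"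
        by (rule sum.swap)
      finally show ?thesis .
    qed
    then show ?thesis
      using i j by (intro exI[of _ "\<lambda>k l. \<gamma> l k"]) simp
  qed
  then obtain \<gamma>' where eq: "\<And>x. q x * (D n (x $ i) * G 0 (x $ j)) = (\<Sum>k\<le>p. \<Sum>l\<le>p. \<gamma>' k l * P k l x)"
    by blast
  show "integrable lborel (\<lambda>x. q x * (D n (x $ i) * G 0 (x $ j)))"
    unfolding eq using P_int by (intro Bochner_Integration.integrable_sum integrable_mult_right)
  show "(LINT x|lborel. q x * (D n (x $ i) * G 0 (x $ j))) = 0"
    unfolding eq using P_int P_0 by (simp add: Bochner_Integration.integral_sum Bochner_Integration.integrable_sum)
qed

lemma L2_on_diff:
  fixes f g :: "'a::euclidean_space \<Rightarrow> real"
  assumes f: "L2_on S f" and g: "L2_on S g"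
  shows "L2_on S (\<lambda>x. f x - g x)"
proof -
  note [measurable] = L2_onD(1)[OF f] L2_onD(1)[OF g]
  have eq: "indicator S x * (f x - g x) = indicator S x * f x - indicator S x * g x" for x
    by (simp add: algebra_simps)
  have meas: "(\<lambda>x. indicator S x * (f x - g x)) \<in> borel_measurable lebesgue"
    unfolding eq by measurable
  have "integrable lebesgue (\<lambda>x. (indicator S x * (f x - g x))\<^sup>2)"
  proof (rule Bochner_Integration.integrable_bound)
    show "integrable lebesgue (\<lambda>x. 2 * (indicator S x * f x)\<^sup>2 + 2 * (indicator S x * g x)\<^sup>2)"
      using L2_onD(2)[OF f] L2_onD(2)[OF g] by simp
    have "(a - b)\<^sup>2 \<le> 2 * a\<^sup>2 + 2 * b\<^sup>2" for a b :: real
      using zero_le_power2[of "a + b"] by (simp add: power2_eq_square algebra_simps)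
    then show "AE x in lebesgue. norm ((indicator S x * (f x - g x))\<^sup>2) \<le>
        norm (2 * (indicator S x * f x)\<^sup>2 + 2 * (indicator S x * g x)\<^sup>2)"
      unfolding eq by (intro AE_I2) (simp add: abs_of_nonneg)
    show "(\<lambda>x. (indicator S x * (f x - g x))\<^sup>2) \<in> borel_measurable lebesgue"
      using meas by measurable
  qed
  moreover have "(\<lambda>x. (indicator S x * (f x - g x))\<^sup>2) = (\<lambda>x. indicator S x *\<^sub>R (norm (f x - g x))\<^sup>2)"
    by (auto simp: indicator_def)
  ultimately show ?thesis
    using meas by (simp add: L2_on_def set_borel_measurable_def set_integrable_def)
qed

text \<open>Boundedness comes from the compact superset \<open>E\<close>, which for a discrete
  function is the union of the active cells.\<close>

lemma L2_on_continuous: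
  fixes f :: "'a::euclidean_space \<Rightarrow> real"
  assumes S: "open S" "S \<subseteq> E" and E: "compact E" and f: "continuous_on E f"
  shows "L2_on S f"
proof -
  have "bounded (f ` E)"
    using E f by (intro compact_imp_bounded compact_continuous_image)
  then obtain B where B: "\<And>x. x \<in> E \<Longrightarrow> \<bar>f x\<bar> \<le> B"
    by (auto simp: bounded_iff)
  have meas: "(\<lambda>x. indicator S x *\<^sub>R f x) \<in> borel_measurable borel"
    using S f by (intro borel_measurable_continuous_on_indicator) (auto intro: continuous_on_subset)
  have "bounded S"
    using S(2) E bounded_subset compact_imp_bounded by blast
  then have Sfin: "emeasure lborel S < \<infinity>"
    using emeasure_bounded_finite by blast
  have "integrable lborel (\<lambda>x. (indicator S x *\<^sub>R f x)\<^sup>2)"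
  proof (rule Bochner_Integration.integrable_bound)
    show "integrable lborel (\<lambda>x. B\<^sup>2 * indicator S x)"
      using S(1) Sfin by (intro integrable_mult_right) (simp add: integrable_indicator_iff)
    show "(\<lambda>x. (indicator S x *\<^sub>R f x)\<^sup>2) \<in> borel_measurable lborel"
      using meas by simp
    show "AE x in lborel. norm ((indicator S x *\<^sub>R f x)\<^sup>2) \<le> norm (B\<^sup>2 * indicator S x)"
    proof (rule AE_I2)
      fix x
      show "norm ((indicator S x *\<^sub>R f x)\<^sup>2) \<le> norm (B\<^sup>2 * indicator S x)"
      proof (cases "x \<in> S")
        case True
        then have "\<bar>f x\<bar>\<^sup>2 \<le> B\<^sup>2"
          using B S(2) by (intro power_mono) auto
        then show ?thesis using True by simp
      qed simp
    qed
  qed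
  moreover have "(\<lambda>x. (indicator S x *\<^sub>R f x)\<^sup>2) = (\<lambda>x. indicator S x *\<^sub>R (norm (f x))\<^sup>2)"
    by (auto simp: indicator_def)
  ultimately have "integrable lebesgue (\<lambda>x. indicator S x *\<^sub>R (norm (f x))\<^sup>2)"
    by (metis (no_types, lifting) integrable_completion borel_measurable_integrable)
  moreover have "(\<lambda>x. indicator S x *\<^sub>R f x) \<in> borel_measurable lebesgue"
    using meas by (simp add: measurable_completion)
  ultimately show ?thesis
    by (simp add: L2_on_def set_borel_measurable_def set_integrable_def)
qed

lemma cartesian_mesh_finite_compact:
  assumes "cartesian_mesh \<T>"
  shows "finite \<T>" "\<And>K. K \<in> \<T> \<Longrightarrow> compact K"
proof -
  obtain m n and xs ys :: "nat \<Rightarrow> real" where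
    eq: "\<T> = {cbox (vector [xs i, ys j]) (vector [xs (Suc i), ys (Suc j)]) | i j. i < m \<and> j < n}"
    using assms by (auto simp: cartesian_mesh_def)
  have "\<T> = (\<lambda>(i, j). cbox (vector [xs i, ys j]) (vector [xs (Suc i), ys (Suc j)])) ` ({..<m} \<times> {..<n})"
    unfolding eq by auto
  then show "finite \<T>" by simp
  show "compact K" if "K \<in> \<T>" for K
    using that unfolding eq by auto
qed

text \<open>A cell with an interior point contains two distinct points, so its diameter is
  positive.\<close>

lemma mesh_size_pos:
  assumes "cartesian_mesh \<T>" "K \<in> \<T>" "x \<in> interior K"
  shows "mesh_size \<T> > 0"
proof -
  note fin = cartesian_mesh_finite_compact[OF assms(1)]
  obtain \<epsilon> where \<epsilon>: "\<epsilon> > 0" "ball x \<epsilon> \<subseteq> K"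
    using assms(3) mem_interior by blast
  have "dist x (x + (\<epsilon> / 2) *\<^sub>R axis 1 1) = \<epsilon> / 2"
    using \<epsilon>(1) by (simp add: dist_norm)
  then have "x + (\<epsilon> / 2) *\<^sub>R axis 1 1 \<in> K" "x \<in> K"
    using \<epsilon> by (auto intro!: subsetD[OF \<epsilon>(2)])
  from diameter_bounded_bound[OF compact_imp_bounded[OF fin(2)[OF assms(2)]] this(2,1)]
  have "0 < diameter K"
    using \<epsilon>(1) \<open>dist x _ = \<epsilon> / 2\<close> by simp
  also have "diameter K \<le> mesh_size \<T>"
    unfolding mesh_size_def using fin(1) assms(2) by (intro Max_ge) auto
  finally show ?thesis .
qed

text \<open>A ball is connected, so if it met both \<open>K\<close> and its complement it would
  contain a frontier point closer than \<open>r\<close>.\<close>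

lemma ball_subset_of_infdist_frontier:
  fixes K :: "'a::euclidean_space set"
  assumes "x \<in> K" "r \<le> infdist x (frontier K)"
  shows "ball x r \<subseteq> K"
proof (rule ccontr)
  assume not: "\<not> ball x r \<subseteq> K"
  then have "r > 0"
    by (metis ball_eq_empty empty_subsetI not_le)
  then have "ball x r \<inter> K \<noteq> {}"
    using assms(1) centre_in_ball by blast
  then obtain z where z: "z \<in> ball x r" "z \<in> frontier K"
    using connected_Int_frontier[of "ball x r" K] not by auto
  have "infdist x (frontier K) \<le> dist x z"
    by (rule infdist_le[OF z(2)])
  then show False
    using z(1) assms(2) by simp
qed

subsection \<open>The lower bound\<close>

theorem corollary3:
  fixes \<Omega> :: "(real ^ 2) set" and x0 :: "real ^ 2" and \<alpha> \<omega> R :: real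
    and u w :: "real ^ 2 \<Rightarrow> real ^ 2" and \<Phi> :: "real \<Rightarrow> real ^ 2"
    and \<Lambda> lam \<epsilon> \<rho> :: real and p :: nat
    and \<F> :: "(real ^ 2) set set set"
  assumes domain: "open \<Omega>" "connected \<Omega>" "bounded \<Omega>" "x0 \<in> frontier \<Omega>"
    and corner: "0 < \<omega>" "\<omega> \<le> 2 * pi" "0 < R"
      "\<Omega> \<inter> ball x0 R = sector x0 \<alpha> \<omega> \<inter> ball x0 R"
    and meshes: "\<And>\<T>. \<T> \<in> \<F> \<Longrightarrow> cartesian_mesh \<T>"
      "\<And>\<T>. \<T> \<in> \<F> \<Longrightarrow> \<Omega> \<subseteq> \<Union>\<T>"
      "quasi_uniform_family \<F>"
    and p: "1 \<le> p"
    and u: "sobolev_H_vec 1 \<Omega> u"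
    and angular: "smooth_curve_on {\<alpha><..<\<alpha> + \<omega>} \<Phi>"
      "\<exists>\<theta>\<in>{\<alpha><..<\<alpha> + \<omega>}. \<Phi> \<theta> \<noteq> 0"
    and exponent: "\<Lambda> \<noteq> 0" "lam \<notin> \<nat>" "0 < lam" "lam < real p"
    and expansion:
      "AE x in lebesgue. \<forall>r \<theta>. 0 < r \<and> r < R \<and> \<alpha> < \<theta> \<and> \<theta> < \<alpha> + \<omega> \<and> x = polar x0 r \<theta> \<longrightarrow>
         u x = (\<Lambda> * r powr lam) *\<^sub>R \<Phi> \<theta> + w x"
    and remainder: "0 < \<epsilon>" "sobolev_H_vec (1 + lam + \<epsilon>) (\<Omega> \<inter> ball x0 R) w"
    and junction: "0 < \<rho>"
      "\<And>\<T>. \<T> \<in> \<F> \<Longrightarrow>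
         \<exists>K\<in>active_cells \<Omega> \<T>.
           x0 \<in> interior K \<and> infdist x0 (frontier K) \<ge> \<rho> * mesh_size \<T>"
  shows "\<exists>c>0. \<exists>h1>0. \<forall>\<T>\<in>\<F>. mesh_size \<T> \<le> h1 \<longrightarrow>
           (\<forall>u_h\<in>fe_space p \<Omega> \<T>.
              L2_norm_on \<Omega> (\<lambda>x. u x - u_h x) \<ge> c * \<bar>\<Lambda>\<bar> * mesh_size \<T> powr (1 + lam))"
proof -

  \<comment> \<open>A ray on which the singular function does not vanish\<close>
  obtain \<theta>0 where \<theta>0: "\<alpha> < \<theta>0" "\<theta>0 < \<alpha> + \<omega>" "\<Phi> \<theta>0 \<noteq> 0"
    using angular(2) by auto
  \<comment> \<open>One component suffices, since the norm of the error dominates each of its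
    components.\<close>
  then obtain k where k: "\<Phi> \<theta>0 $ k \<noteq> 0"
    by (metis vec_eq_iff zero_index)
  define e :: "real ^ 2" where "e = vector [cos \<theta>0, sin \<theta>0]"
  obtain V ang where V: "open V" "continuous_on V ang"
    and ray: "\<And>t. t > 0 \<Longrightarrow> t *\<^sub>R e \<in> V \<and> ang (t *\<^sub>R e) = \<theta>0"
    and ang_scale: "\<And>h y. h > 0 \<Longrightarrow> ang (h *\<^sub>R y) = ang y"
    and V_ang: "\<And>y. y \<in> V \<Longrightarrow> y \<noteq> 0 \<and> \<alpha> < ang y \<and> ang y < \<alpha> + \<omega>"
    and V_polar: "\<And>x0 y. y \<in> V \<Longrightarrow> polar x0 (norm y) (ang y) = x0 + y"
    using sector_chart[OF \<theta>0(1,2)] unfolding e_def by metis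
  have norm_e: "norm e = 1"
    by (simp add: e_def norm_vec_def L2_set_def sum_2)
  \<comment> \<open>Component \<open>k\<close> of the singular function, moved to the origin and
    with the factor \<open>\<Lambda>\<close> removed.\<close>
  define F where "F = (\<lambda>y. norm y powr lam * \<Phi> (ang y) $ k)"
  have \<Phi>_cont: "continuous_on {\<alpha><..<\<alpha> + \<omega>} \<Phi>"
    using angular(1) unfolding smooth_curve_on_def
    by (metis continuous_at_imp_continuous_on has_vector_derivative_continuous)
  have "continuous_on V (\<lambda>y. \<Phi> (ang y))"
    using V_ang by (intro continuous_on_compose2[OF \<Phi>_cont V(2)]) auto
  \<comment> \<open>The ball of radius \<open>\<rho>\<close> becomes, after scaling by
    \<open>h\<close>, a ball around \<open>x0\<close> inside the cell.\<close>
  then have F_cont: "continuous_on (V \<inter> ball 0 \<rho>) F"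
    unfolding F_def using V_ang
    by (intro continuous_intros) (auto intro: continuous_on_subset)
  have F_ray: "F (t *\<^sub>R e) = \<Phi> \<theta>0 $ k * t powr lam" if "t > 0" for t
    using ray[OF that] that norm_e by (simp add: F_def)
  have F_scale: "F (h *\<^sub>R y) = h powr lam * F y" if "h > 0" for h y
    using that ang_scale[OF that] by (simp add: F_def powr_mult)

  \<comment> \<open>The order of the remainder and the fixed test function\<close>
  define s where "s = 1 + lam + \<epsilon>"
  \<comment> \<open>\<open>w\<close> has weak derivatives up to order \<open>m\<close>, with
    additional fractional smoothness of order \<open>\<sigma>\<close> unless \<open>s\<close> is an
    integer.\<close>
  define m where "m = nat \<lfloor>s\<rfloor>"
  define \<sigma> where "\<sigma> = frac s"
  have s_pos: "s > 0"
    using exponent remainder by (simp add: s_def)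
  then have m\<sigma>: "real m + \<sigma> = s" "\<sigma> \<ge> 0"
    by (simp_all add: m_def \<sigma>_def frac_def)
  \<comment> \<open>\<open>p + 1\<close> derivatives annihilate \<open>\<Q>\<^sub>p\<close>, and \<open>m\<close> further ones are moved onto \<open>w\<close>\<close>
  define M where "M = p + 1 + m"
  have half: "(\<rho> / 2) *\<^sub>R e \<in> V \<inter> ball 0 \<rho>" "\<rho> / 2 > 0"
    using ray[of "\<rho> / 2"] junction(1) norm_e by auto
  obtain i j :: 2 and D G c \<kappa> where ij: "i \<noteq> j" and D: "smooth_family D" and G: "smooth_family G"
    and \<kappa>: "\<kappa> > 0" and cube_sub: "cube c \<kappa> \<subseteq> V \<inter> ball 0 \<rho>"
    and D_supp: "\<And>t. \<kappa> < \<bar>t - c $ i\<bar> \<Longrightarrow> D 0 t = 0" and G_supp: "\<And>t. \<kappa> < \<bar>t - c $ j\<bar> \<Longrightarrow> G 0 t = 0"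
    and I_nz: "(LINT y|lborel. indicator (cube c \<kappa>) y * F y * (D M (y $ i) * G 0 (y $ j))) \<noteq> 0"
  proof -
    show thesis
      by (rule tensor_nonvanishing[OF open_Int[OF V(1) open_ball] F_cont norm_e half(2,1) F_ray k exponent(2), where M = M])
        (assumption, rule that)
  qed

  \<comment> \<open>Constants independent of the mesh\<close>
  define I0 where "I0 = (LINT y|lborel. indicator (cube c \<kappa>) y * F y * (D M (y $ i) * G 0 (y $ j)))"
  have tensor_bound: "\<exists>B>0. \<forall>x::real^2. \<bar>D n (x $ i) * G 0 (x $ j)\<bar> \<le> B" for n
  proof -
    have "bump_deriv n (c $ i) \<kappa> (D n)" "bump_deriv 0 (c $ j) \<kappa> (G 0)"
      using D G D_supp G_supp unfolding bump_deriv_def by blast+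
    then have "bounded_borel (\<lambda>x::real^2. D n (x $ i) * G 0 (x $ j))"
      by (intro bounded_borel_tensor bump_deriv_bounded_borel(1))
    then obtain B where B: "\<bar>D n (x $ i) * G 0 (x $ j)\<bar> \<le> B" for x :: "real^2"
      unfolding bounded_borel_def by blast
    have "\<bar>D n (x $ i) * G 0 (x $ j)\<bar> \<le> \<bar>B\<bar> + 1" for x :: "real^2"
      using B[of x] by linarith
    then show ?thesis
      by (intro exI[of _ "\<bar>B\<bar> + 1"]) simp
  qed
  obtain B1 where B1: "B1 > 0" "\<And>x::real^2. \<bar>D M (x $ i) * G 0 (x $ j)\<bar> \<le> B1"
    using tensor_bound[of M] by blast
  obtain B2 where B2: "B2 > 0" "\<And>x::real^2. \<bar>D (p + 1) (x $ i) * G 0 (x $ j)\<bar> \<le> B2"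
    using tensor_bound[of "p + 1"] by blast
  define S where "S = \<Omega> \<inter> ball x0 R"
  have w: "sobolev_H s S (\<lambda>x. w x $ k)"
    using remainder(2) by (simp add: sobolev_H_vec_def s_def S_def)
  then have w_L2: "L2_on S (\<lambda>x. w x $ k)"
    by (simp add: sobolev_H_def)
  obtain g where g: "L2_on S g" "weak_partials S (replicate m i) (\<lambda>x. w x $ k) g"
    "0 < \<sigma> \<Longrightarrow> finite_gagliardo \<sigma> S g"
  proof -
    have "\<forall>is. length is \<le> m \<longrightarrow> (\<exists>g. L2_on S g \<and> weak_partials S is (\<lambda>x. w x $ k) g \<and>
        (length is = m \<and> \<sigma> > 0 \<longrightarrow> finite_gagliardo \<sigma> S g))"
      using w unfolding sobolev_H_def m_def \<sigma>_def by blast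
    from this[rule_format, of "replicate m i"] show thesis
      using that by auto
  qed
  obtain Cg where Cg: "Cg \<ge> 0" and Cg_le: "\<forall>Q \<psi> B d. Q \<in> lmeasurable \<and> Q \<subseteq> S \<and>
      0 < measure lebesgue Q \<and> measure lebesgue Q \<le> d\<^sup>2 \<and>
      0 < d \<and> (\<forall>x\<in>Q. \<forall>y\<in>Q. norm (x - y) \<le> d) \<and>
      \<psi> \<in> borel_measurable borel \<and> (\<forall>x. \<bar>\<psi> x\<bar> \<le> B) \<and> (\<forall>x. x \<notin> Q \<longrightarrow> \<psi> x = 0) \<and>
      integral\<^sup>L lebesgue \<psi> = 0 \<longrightarrow>
      \<bar>LINT x:S|lebesgue. g x * \<psi> x\<bar> \<le> Cg * B * d powr (1 + \<sigma>)"
    using sobolev_pairing_le[OF g(1,3) m\<sigma>(2)] by blast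
  \<comment> \<open>The summand \<open>1\<close> keeps \<open>C2\<close> positive when
    \<open>Cg = 0\<close>, since it appears as a divisor in \<open>h1\<close>.\<close>
  define C2 where "C2 = Cg * B2 * (4 * \<kappa>) powr (1 + \<sigma>) + 1"
  have C2: "C2 > 0"
    using Cg B2(1) by (simp add: C2_def add_nonneg_pos)
  \<comment> \<open>The first bound keeps the scaled ball inside the corner neighbourhood; the
    second makes the remainder at most half of the singular term.\<close>
  define h1 where "h1 = min (R / \<rho>) ((\<bar>\<Lambda>\<bar> * \<bar>I0\<bar> / (2 * C2)) powr (1 / \<epsilon>))"
  have I0: "\<bar>I0\<bar> > 0"
    using I_nz by (simp add: I0_def)
  have h1: "h1 > 0"
    using corner(3) junction(1) exponent(1) I0 C2 by (simp add: h1_def)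

  \<comment> \<open>The estimate on a single mesh\<close>
  have main: "\<bar>I0\<bar> / (4 * B1 * \<kappa>) * \<bar>\<Lambda>\<bar> * mesh_size \<T> powr (1 + lam) \<le> L2_norm_on \<Omega> (\<lambda>x. u x - u_h x)"
    if \<T>: "\<T> \<in> \<F>" and small: "mesh_size \<T> \<le> h1" and u_h: "u_h \<in> fe_space p \<Omega> \<T>" for \<T> u_h
  proof -
    define h where "h = mesh_size \<T>"
    obtain K where K: "K \<in> active_cells \<Omega> \<T>" "x0 \<in> interior K" "infdist x0 (frontier K) \<ge> \<rho> * h"
      using junction(2)[OF \<T>] by (auto simp: h_def)
    have h: "h > 0"
      using mesh_size_pos[OF meshes(1)[OF \<T>] _ K(2)] K(1) by (simp add: active_cells_def h_def)
    have ball_K: "ball x0 (\<rho> * h) \<subseteq> K"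
      using K(2,3) interior_subset by (intro ball_subset_of_infdist_frontier) auto
    have "h \<le> R / \<rho>" and h_small: "h \<le> (\<bar>\<Lambda>\<bar> * \<bar>I0\<bar> / (2 * C2)) powr (1 / \<epsilon>)"
      using small by (auto simp: h1_def h_def)
    then have h_R: "\<rho> * h \<le> R"
      using junction(1) by (simp add: field_simps)
    \<comment> \<open>The image of \<open>cube c \<kappa>\<close> under the dilation that sends the
      origin to \<open>x0\<close> and has factor \<open>h\<close>; \<open>Y\<close> is its
      inverse.\<close>
    define Q where "Q = cube (x0 + h *\<^sub>R c) (h * \<kappa>)"
    define Y where "Y = (\<lambda>x. (1 / h) *\<^sub>R (x - x0))"
    have Y_comp: "Y x $ l = (x $ l - x0 $ l) / h" for x l
      by (simp add: Y_def)
    have Y_inv: "x = x0 + h *\<^sub>R Y x" for x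
      using h by (simp add: Y_def)
    have Q_iff: "x \<in> Q \<longleftrightarrow> Y x \<in> cube c \<kappa>" for x
    proof -
      have "\<bar>x $ l - (x0 + h *\<^sub>R c) $ l\<bar> = h * \<bar>Y x $ l - c $ l\<bar>" for l
      proof -
        have "x $ l - (x0 + h *\<^sub>R c) $ l = h * (Y x $ l - c $ l)"
          using h by (simp add: Y_comp field_simps)
        then show ?thesis using h by (simp add: abs_mult)
      qed
      then show ?thesis
        using h by (simp add: Q_def cube_def)
    qed
    have Q_measure: "Q \<in> lmeasurable" "measure lebesgue Q = 4 * (h * \<kappa>)\<^sup>2"
      unfolding Q_def using h \<kappa> by (simp_all add: measure_cube)
    have Q_ball: "x \<in> ball x0 (\<rho> * h)" and Q_sector: "x \<in> sector x0 \<alpha> \<omega>"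
      and Q_polar: "x = polar x0 (norm (x - x0)) (ang (Y x))" "norm (x - x0) = h * norm (Y x)" "0 < norm (x - x0)"
        "\<alpha> < ang (Y x)" "ang (Y x) < \<alpha> + \<omega>"
      if x: "x \<in> Q" for x
    proof -
      have y: "Y x \<in> V" "norm (Y x) < \<rho>"
        using x cube_sub by (auto simp: Q_iff)
      show nx: "norm (x - x0) = h * norm (Y x)"
        using h by (simp add: Y_def)
      then show "x \<in> ball x0 (\<rho> * h)"
        using y h by (simp add: dist_norm norm_minus_commute mult.commute)
      show pos: "0 < norm (x - x0)"
        using nx h V_ang[OF y(1)] by simp
      show ang: "\<alpha> < ang (Y x)" "ang (Y x) < \<alpha> + \<omega>"
        using V_ang[OF y(1)] by auto
      have "polar x0 (norm (x - x0)) (ang (Y x)) = x0 + h *\<^sub>R (polar 0 (norm (Y x)) (ang (Y x)))"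
        by (simp add: polar_def nx)
      also have "\<dots> = x"
        using V_polar[OF y(1), of 0] Y_inv[of x] by simp
      finally show polar: "x = polar x0 (norm (x - x0)) (ang (Y x))" by simp
      show "x \<in> sector x0 \<alpha> \<omega>"
        unfolding sector_def using polar pos ang by blast
    qed
    have Q_S: "Q \<subseteq> S"
    proof
      fix x assume x: "x \<in> Q"
      then have "x \<in> ball x0 R"
        using Q_ball[OF x] h_R by auto
      then show "x \<in> S"
        using corner(4) Q_sector[OF x] unfolding S_def by blast
    qed
    have Q_K: "Q \<subseteq> K"
      using Q_ball ball_K by blast
    have Q_diam: "norm (x - y) \<le> 4 * \<kappa> * h" if "x \<in> Q" "y \<in> Q" for x y
    proof -
      have "norm (x - y) \<le> norm (x - (x0 + h *\<^sub>R c)) + norm (y - (x0 + h *\<^sub>R c))"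
        using norm_triangle_ineq4[of "x - (x0 + h *\<^sub>R c)" "y - (x0 + h *\<^sub>R c)"] by simp
      also have "\<dots> \<le> 2 * (h * \<kappa>) + 2 * (h * \<kappa>)"
        using that unfolding Q_def by (intro add_mono cube_norm_le)
      finally show ?thesis by (simp add: mult_ac)
    qed

    \<comment> \<open>The rescaled test function and its orthogonality to polynomials\<close>
    define D' where "D' = (\<lambda>n t. (1 / h) ^ n * D n ((t - x0 $ i) / h))"
    define G' where "G' = (\<lambda>n t. (1 / h) ^ n * G n ((t - x0 $ j) / h))"
    have D': "smooth_family D'" and G': "smooth_family G'"
      unfolding D'_def G'_def using D G by (simp_all add: smooth_family_rescale)
    have D'_supp: "D' 0 t = 0" if "h * \<kappa> < \<bar>t - (x0 + h *\<^sub>R c) $ i\<bar>" for t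
    proof -
      have "t - (x0 + h *\<^sub>R c) $ i = h * ((t - x0 $ i) / h - c $ i)"
        using h by (simp add: field_simps)
      then have "\<kappa> < \<bar>(t - x0 $ i) / h - c $ i\<bar>"
        using that h by (simp add: abs_mult)
      then show ?thesis by (simp add: D'_def D_supp)
    qed
    have G'_supp: "G' 0 t = 0" if "h * \<kappa> < \<bar>t - (x0 + h *\<^sub>R c) $ j\<bar>" for t
    proof -
      have "t - (x0 + h *\<^sub>R c) $ j = h * ((t - x0 $ j) / h - c $ j)"
        using h by (simp add: field_simps)
      then have "\<kappa> < \<bar>(t - x0 $ j) / h - c $ j\<bar>"
        using that h by (simp add: abs_mult)
      then show ?thesis by (simp add: G'_def G_supp)
    qed
    \<comment> \<open>The powers of \<open>1 / h\<close> in \<open>D'\<close> are dropped here, so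
      the bound on \<open>\<psi> n\<close> does not depend on \<open>h\<close>.\<close>
    define \<psi> where "\<psi> = (\<lambda>n x. D n (Y x $ i) * G 0 (Y x $ j))"
    have \<psi>_eq: "\<psi> n x = h ^ n * (D' n (x $ i) * G' 0 (x $ j))" for n x
      using h by (simp add: \<psi>_def D'_def G'_def Y_comp power_one_over field_simps)
    have \<psi>_supp: "\<psi> n x = 0" if x: "x \<notin> Q" for n x
    proof -
      obtain l where l: "\<kappa> < \<bar>Y x $ l - c $ l\<bar>"
        using x unfolding Q_iff cube_def mem_Collect_eq not_all not_le by blast
      have "l = i \<or> l = j"
        using UNIV_2_eq[OF ij] by blast
      then show ?thesis
        using l smooth_family_support[OF D D_supp] smooth_family_support[OF G G_supp]
        by (auto simp: \<psi>_def)
    qed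
    have \<psi>_meas: "\<psi> n \<in> borel_measurable borel" for n
    proof -
      have [measurable]: "D' n \<in> borel_measurable borel" "G' 0 \<in> borel_measurable borel"
        using smooth_family_continuous[OF D'] smooth_family_continuous[OF G']
        by (simp_all add: borel_measurable_continuous_onI)
      show ?thesis
        unfolding \<psi>_eq[abs_def] by measurable
    qed
    have \<psi>_orth: "integrable lborel (\<lambda>x. q x * \<psi> n x)" "(LINT x|lborel. q x * \<psi> n x) = 0"
      if q: "q = (\<lambda>x::real^2. \<Sum>k\<le>d. \<Sum>l\<le>d. \<gamma> k l * (x $ 1) ^ k * (x $ 2) ^ l)" and "d < n" for q d \<gamma> n
    proof -
      note moment = tensor_moment_eq_0[OF ij D' D'_supp G' G'_supp q \<open>d < n\<close>]
      have eq: "(\<lambda>x. q x * \<psi> n x) = (\<lambda>x. h ^ n * (q x * (D' n (x $ i) * G' 0 (x $ j))))"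
        by (simp add: \<psi>_eq fun_eq_iff)
      show "integrable lborel (\<lambda>x. q x * \<psi> n x)" "(LINT x|lborel. q x * \<psi> n x) = 0"
        unfolding eq using moment by simp_all
    qed
    \<comment> \<open>Mean zero is orthogonality to the constant polynomial, the case of degree
      zero.\<close>
    have \<psi>_mean: "integral\<^sup>L lebesgue (\<psi> (p + 1)) = 0"
      using \<psi>_orth(2)[where q = "\<lambda>_. 1" and d = 0 and \<gamma> = "\<lambda>_ _. 1" and n = "p + 1"] integral_completion[of "\<psi> (p + 1)" lborel] \<psi>_meas
      by simp

    \<comment> \<open>Pairing with the remainder\<close>
    have w_part: "\<bar>LINT x:S|lebesgue. w x $ k * \<psi> M x\<bar> \<le> C2 * h powr (2 + lam + \<epsilon>)"
    proof -
      \<comment> \<open>Only \<open>m\<close> of the \<open>M\<close> derivatives are moved onto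
        \<open>w\<close>; the other \<open>p + 1\<close> remain in the test function and give it
        mean zero.\<close>
      have test: "test_function S (\<lambda>x. D' (p + 1) (x $ i) * G' 0 (x $ j))"
      proof (rule test_function_tensor[OF D' G' ij _ Q_S])
        show "compact Q" by (simp add: Q_def cube_eq_cbox)
        show "D' (p + 1) (x $ i) * G' 0 (x $ j) = 0" if "x \<notin> Q" for x
          using \<psi>_supp[OF that, of "p + 1"] h by (simp add: \<psi>_eq)
      qed
      have "(LINT x:S|lebesgue. w x $ k * \<psi> M x) = h ^ M * (LINT x:S|lebesgue. w x $ k * (D' M (x $ i) * G' 0 (x $ j)))"
        by (subst set_integral_mult_right[symmetric]) (simp add: \<psi>_eq mult_ac)
      also have "(LINT x:S|lebesgue. w x $ k * (D' M (x $ i) * G' 0 (x $ j))) =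
          (- 1) ^ m * (LINT x:S|lebesgue. g x * (D' (p + 1) (x $ i) * G' 0 (x $ j)))"
        using g(2) test partials_replicate_tensor[OF D' G' ij, of m "p + 1" 0]
        unfolding weak_partials_def by (auto simp: M_def)
      \<comment> \<open>Of the power \<open>h ^ M\<close>, the factor \<open>h ^ (p + 1)\<close>
        turns the remaining test function back into \<open>\<psi> (p + 1)\<close>, and
        \<open>h ^ m\<close> is gained.\<close>
      also have "h ^ M * \<dots> = (- 1) ^ m * h ^ m * (h ^ (p + 1) * (LINT x:S|lebesgue. g x * (D' (p + 1) (x $ i) * G' 0 (x $ j))))"
        by (simp add: M_def power_add)
      also have "h ^ (p + 1) * (LINT x:S|lebesgue. g x * (D' (p + 1) (x $ i) * G' 0 (x $ j))) =
          (LINT x:S|lebesgue. g x * \<psi> (p + 1) x)"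
        by (subst set_integral_mult_right[symmetric]) (simp add: \<psi>_eq mult_ac)
      finally have "\<bar>LINT x:S|lebesgue. w x $ k * \<psi> M x\<bar> = h ^ m * \<bar>LINT x:S|lebesgue. g x * \<psi> (p + 1) x\<bar>"
        using h by (simp add: abs_mult power_abs)
      also have "\<bar>LINT x:S|lebesgue. g x * \<psi> (p + 1) x\<bar> \<le> Cg * B2 * (4 * \<kappa> * h) powr (1 + \<sigma>)"
      proof -
        have "\<bar>\<psi> (p + 1) x\<bar> \<le> B2" for x
          unfolding \<psi>_def by (rule B2(2))
        moreover have "0 < measure lebesgue Q" "measure lebesgue Q \<le> (4 * \<kappa> * h)\<^sup>2" "0 < 4 * \<kappa> * h"
          using h \<kappa> by (simp_all add: Q_measure(2) power_mult_distrib)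
        ultimately show ?thesis
          using Q_measure(1) Q_S Q_diam \<psi>_meas \<psi>_supp \<psi>_mean
          by (intro Cg_le[rule_format] conjI ballI allI impI)
      qed
      also have "(4 * \<kappa> * h) powr (1 + \<sigma>) = (4 * \<kappa>) powr (1 + \<sigma>) * h powr (1 + \<sigma>)"
        using h \<kappa> by (simp add: powr_mult)
      also have "h ^ m * (Cg * B2 * ((4 * \<kappa>) powr (1 + \<sigma>) * h powr (1 + \<sigma>))) =
          (C2 - 1) * (h ^ m * h powr (1 + \<sigma>))"
        by (simp add: C2_def mult_ac)
      \<comment> \<open>The gain \<open>m\<close> and the exponent \<open>1 + \<sigma>\<close> add
        up to \<open>1 + s\<close>.\<close>
      also have "h ^ m * h powr (1 + \<sigma>) = h powr (2 + lam + \<epsilon>)"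
      proof -
        have "h ^ m * h powr (1 + \<sigma>) = h powr (real m + (1 + \<sigma>))"
          using h by (simp add: powr_add powr_realpow)
        also have "real m + (1 + \<sigma>) = 2 + lam + \<epsilon>"
          using m\<sigma>(1) by (simp add: s_def)
        finally show ?thesis .
      qed
      also have "(C2 - 1) * h powr (2 + lam + \<epsilon>) \<le> C2 * h powr (2 + lam + \<epsilon>)"
        by (intro mult_right_mono) auto
      finally show ?thesis
        using h by (simp add: mult_left_mono)
    qed

    \<comment> \<open>Upper bound of the pairing by the discretization error\<close>
    define v where "v = (\<lambda>x. u x $ k - u_h x $ k)"
    define E where "E = \<Union>(active_cells \<Omega> \<T>)"
    note mesh = cartesian_mesh_finite_compact[OF meshes(1)[OF \<T>]]
    have E: "compact E" "\<Omega> \<subseteq> E"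
    proof -
      show "compact E"
        unfolding E_def active_cells_def using mesh by (intro compact_Union) auto
      show "\<Omega> \<subseteq> E"
        using meshes(2)[OF \<T>] unfolding E_def active_cells_def by blast
    qed
    have L2_comp: "L2_on \<Omega> (\<lambda>x. u x $ l - u_h x $ l)" for l
    proof (rule L2_on_diff)
      show "L2_on \<Omega> (\<lambda>x. u x $ l)"
        using u by (simp add: sobolev_H_vec_def sobolev_H_def)
      have "continuous_on E u_h"
        using u_h by (simp add: fe_space_def E_def)
      then show "L2_on \<Omega> (\<lambda>x. u_h x $ l)"
        by (intro L2_on_continuous[OF domain(1) E(2,1)] continuous_intros)
    qed
    have v_norm: "sqrt (LINT x:\<Omega>|lebesgue. (v x)\<^sup>2) \<le> L2_norm_on \<Omega> (\<lambda>x. u x - u_h x)"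
    proof -
      have norm_eq: "(norm (u x - u_h x))\<^sup>2 = (u x $ 1 - u_h x $ 1)\<^sup>2 + (u x $ 2 - u_h x $ 2)\<^sup>2" for x
        by (simp add: norm_vec_def L2_set_def sum_2)
      have int: "set_integrable lebesgue \<Omega> (\<lambda>x. (u x $ l - u_h x $ l)\<^sup>2)" for l
        using L2_comp[of l] by (simp add: L2_on_def)
      have "(LINT x:\<Omega>|lebesgue. (v x)\<^sup>2) \<le> (LINT x:\<Omega>|lebesgue. (norm (u x - u_h x))\<^sup>2)"
      proof (rule set_integral_mono)
        show "set_integrable lebesgue \<Omega> (\<lambda>x. (v x)\<^sup>2)"
          unfolding v_def by (rule int)
        show "set_integrable lebesgue \<Omega> (\<lambda>x. (norm (u x - u_h x))\<^sup>2)"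
          unfolding norm_eq by (intro set_integral_add(1) int)
        show "(v x)\<^sup>2 \<le> (norm (u x - u_h x))\<^sup>2" for x
          unfolding norm_eq v_def using exhaust_2[of k] by auto
      qed
      then show ?thesis
        by (simp add: L2_norm_on_def)
    qed
    have upper: "\<bar>LINT x:\<Omega>|lebesgue. v x * \<psi> M x\<bar> \<le> B1 * (2 * h * \<kappa>) * L2_norm_on \<Omega> (\<lambda>x. u x - u_h x)"
    proof -
      have "\<bar>LINT x:\<Omega>|lebesgue. v x * \<psi> M x\<bar> \<le>
          B1 * sqrt (measure lebesgue Q * (LINT x:\<Omega>|lebesgue. (v x)\<^sup>2))"
      proof (rule L2_on_pairing_le(2)[OF _ Q_measure(1) _ \<psi>_meas _ \<psi>_supp])
        show "L2_on \<Omega> v" unfolding v_def by (rule L2_comp)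
        show "Q \<subseteq> \<Omega>" using Q_S by (auto simp: S_def)
        show "\<bar>\<psi> M x\<bar> \<le> B1" for x
          unfolding \<psi>_def by (rule B1(2))
      qed
      also have "sqrt (measure lebesgue Q * (LINT x:\<Omega>|lebesgue. (v x)\<^sup>2)) =
          (2 * h * \<kappa>) * sqrt (LINT x:\<Omega>|lebesgue. (v x)\<^sup>2)"
      proof -
        have "measure lebesgue Q = (2 * h * \<kappa>)\<^sup>2"
          by (simp add: Q_measure(2) power_mult_distrib)
        then show ?thesis
          using h \<kappa> by (simp add: real_sqrt_mult real_sqrt_abs)
      qed
      also have "B1 * ((2 * h * \<kappa>) * sqrt (LINT x:\<Omega>|lebesgue. (v x)\<^sup>2)) \<le>
          B1 * ((2 * h * \<kappa>) * L2_norm_on \<Omega> (\<lambda>x. u x - u_h x))"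
        using B1(1) h \<kappa> v_norm by (intro mult_left_mono) auto
      finally show ?thesis by (simp add: mult.assoc)
    qed

    \<comment> \<open>Splitting the pairing into singular, remainder and polynomial parts\<close>
    obtain q \<gamma> where q: "q = (\<lambda>x::real^2. \<Sum>k\<le>p. \<Sum>l\<le>p. \<gamma> k l * (x $ 1) ^ k * (x $ 2) ^ l)"
      and q_K: "\<And>x. x \<in> K \<Longrightarrow> u_h x $ k = q x"
      using u_h K(1) unfolding fe_space_def Q_poly_on_def by blast
    define P where "P = (\<lambda>y. indicator (cube c \<kappa>) y * F y * (D M (y $ i) * G 0 (y $ j)))"
    \<comment> \<open>A function that is not integrable has integral zero by convention, so the
      nonzero value of \<open>I0\<close> yields integrability.\<close>
    have P_int: "integrable lborel P"
      using I_nz not_integrable_integral_eq unfolding P_def by blast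
    \<comment> \<open>\<open>u_h\<close> equals \<open>q\<close> only on \<open>K\<close>, but
      \<open>\<psi> M\<close> vanishes off \<open>Q \<subseteq> K\<close>, so the polynomial may be
      used on the whole plane.\<close>
    have identity: "AE x in lebesgue. indicator \<Omega> x * (v x * \<psi> M x) =
      \<Lambda> * h powr lam * P (Y x) + indicator S x * (w x $ k * \<psi> M x) - q x * \<psi> M x"
      using expansion
    proof eventually_elim
      case (elim x)
      show ?case
      proof (cases "x \<in> Q")
        case True
        then have x: "x \<in> S" "x \<in> \<Omega>" "x \<in> K"
          using Q_S Q_K by (auto simp: S_def)
        have "norm (x - x0) < R"
          using Q_ball[OF True] h_R by (simp add: dist_norm norm_minus_commute)
        then have "u x = (\<Lambda> * norm (x - x0) powr lam) *\<^sub>R \<Phi> (ang (Y x)) + w x"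
          using elim Q_polar[OF True] by blast
        then have "u x $ k = \<Lambda> * h powr lam * F (Y x) + w x $ k"
          using h by (simp add: F_def Q_polar(2)[OF True] powr_mult)
        then have v_eq: "v x = \<Lambda> * h powr lam * F (Y x) + w x $ k - q x"
          using q_K[OF x(3)] by (simp add: v_def)
        have "P (Y x) = F (Y x) * \<psi> M x"
          using True by (simp add: P_def \<psi>_def Q_iff)
        then show ?thesis
          using x by (simp add: v_eq algebra_simps)
      next
        case False
        then show ?thesis
          using \<psi>_supp[OF False] by (simp add: P_def Q_iff)
      qed
    qed
    have PY: "integrable lebesgue (\<lambda>x. P (Y x))" "(LINT x|lebesgue. P (Y x)) = h\<^sup>2 * I0"
    proof -
      have int: "integrable lborel (\<lambda>x. P (Y x))" and val: "(LINT x|lborel. P (Y x)) = h\<^sup>2 * I0"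
        unfolding Y_def I0_def P_def[symmetric] using lborel_integral_rescale[OF P_int h] by auto
      then show "integrable lebesgue (\<lambda>x. P (Y x))" "(LINT x|lebesgue. P (Y x)) = h\<^sup>2 * I0"
        by (simp_all add: integrable_completion integral_completion)
    qed
    have q\<psi>: "integrable lebesgue (\<lambda>x. q x * \<psi> M x)" "(LINT x|lebesgue. q x * \<psi> M x) = 0"
    proof -
      have "integrable lborel (\<lambda>x. q x * \<psi> M x)" "(LINT x|lborel. q x * \<psi> M x) = 0"
        using \<psi>_orth[OF q, of M] by (simp_all add: M_def)
      then show "integrable lebesgue (\<lambda>x. q x * \<psi> M x)" "(LINT x|lebesgue. q x * \<psi> M x) = 0"
        by (simp_all add: integrable_completion integral_completion)
    qed
    have w\<psi>: "integrable lebesgue (\<lambda>x. indicator S x * (w x $ k * \<psi> M x))"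
    proof -
      have "set_integrable lebesgue S (\<lambda>x. w x $ k * \<psi> M x)"
      proof (rule L2_on_pairing_le(1)[OF w_L2 Q_measure(1) Q_S \<psi>_meas _ \<psi>_supp])
        show "\<bar>\<psi> M x\<bar> \<le> B1" for x
          unfolding \<psi>_def by (rule B1(2))
      qed
      then show ?thesis by (simp add: set_integrable_def)
    qed
    have v\<psi>: "set_integrable lebesgue \<Omega> (\<lambda>x. v x * \<psi> M x)"
    proof (rule L2_on_pairing_le(1)[OF _ Q_measure(1) _ \<psi>_meas _ \<psi>_supp])
      show "L2_on \<Omega> v" unfolding v_def by (rule L2_comp)
      show "Q \<subseteq> \<Omega>" using Q_S by (auto simp: S_def)
      show "\<bar>\<psi> M x\<bar> \<le> B1" for x
        unfolding \<psi>_def by (rule B1(2))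
    qed
    have "(LINT x:\<Omega>|lebesgue. v x * \<psi> M x) = (LINT x|lebesgue. \<Lambda> * h powr lam * P (Y x)
        + indicator S x * (w x $ k * \<psi> M x) - q x * \<psi> M x)"
      unfolding set_lebesgue_integral_def real_scaleR_def
    proof (rule integral_cong_AE[OF _ _ identity])
      show "(\<lambda>x. indicator \<Omega> x * (v x * \<psi> M x)) \<in> borel_measurable lebesgue"
        using v\<psi> by (simp add: set_integrable_def borel_measurable_integrable)
      show "(\<lambda>x. \<Lambda> * h powr lam * P (Y x) + indicator S x * (w x $ k * \<psi> M x) - q x * \<psi> M x)
          \<in> borel_measurable lebesgue"
        by (intro borel_measurable_integrable Bochner_Integration.integrable_add
            Bochner_Integration.integrable_diff integrable_mult_right PY q\<psi> w\<psi>)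
    qed
    also have "\<dots> = \<Lambda> * h powr lam * (h\<^sup>2 * I0) + (LINT x:S|lebesgue. w x $ k * \<psi> M x)"
      using PY q\<psi> w\<psi> by (simp add: set_lebesgue_integral_def)
    finally have "\<bar>\<Lambda> * h powr lam * (h\<^sup>2 * I0)\<bar> \<le>
        \<bar>LINT x:\<Omega>|lebesgue. v x * \<psi> M x\<bar> + \<bar>LINT x:S|lebesgue. w x $ k * \<psi> M x\<bar>"
      by linarith
    also have "\<dots> \<le> B1 * (2 * h * \<kappa>) * L2_norm_on \<Omega> (\<lambda>x. u x - u_h x) + C2 * h powr (2 + lam + \<epsilon>)"
      by (rule add_mono[OF upper w_part])
    finally have lower: "\<bar>\<Lambda> * h powr lam * (h\<^sup>2 * I0)\<bar> \<le>
        B1 * (2 * h * \<kappa>) * L2_norm_on \<Omega> (\<lambda>x. u x - u_h x) + C2 * h powr (2 + lam + \<epsilon>)" .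

    \<comment> \<open>Absorbing the remainder\<close>
    have absorb: "C2 * h powr (2 + lam + \<epsilon>) \<le> \<bar>\<Lambda>\<bar> * \<bar>I0\<bar> / 2 * h powr (2 + lam)"
    proof -
      \<comment> \<open>Here the second bound in \<open>h1\<close> is used: the power
        \<open>\<epsilon>\<close> undoes its exponent \<open>1 / \<epsilon>\<close>.\<close>
      have "h powr \<epsilon> \<le> ((\<bar>\<Lambda>\<bar> * \<bar>I0\<bar> / (2 * C2)) powr (1 / \<epsilon>)) powr \<epsilon>"
        using h h_small remainder(1) by (intro powr_mono2) auto
      also have "\<dots> = \<bar>\<Lambda>\<bar> * \<bar>I0\<bar> / (2 * C2)"
        using C2 remainder(1) exponent(1) I0 by (simp add: powr_powr)
      finally have "C2 * h powr \<epsilon> \<le> \<bar>\<Lambda>\<bar> * \<bar>I0\<bar> / 2"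
        using C2 by (simp add: field_simps)
      then have "C2 * h powr \<epsilon> * h powr (2 + lam) \<le> \<bar>\<Lambda>\<bar> * \<bar>I0\<bar> / 2 * h powr (2 + lam)"
        by (rule mult_right_mono) simp
      then show ?thesis
        by (simp add: powr_add mult_ac)
    qed
    have "\<bar>\<Lambda> * h powr lam * (h\<^sup>2 * I0)\<bar> = \<bar>\<Lambda>\<bar> * \<bar>I0\<bar> * h powr (2 + lam)"
      using h by (simp add: abs_mult powr_add powr_realpow[of h 2, simplified] mult_ac)
    with lower absorb have "\<bar>\<Lambda>\<bar> * \<bar>I0\<bar> / 2 * h powr (2 + lam) \<le>
        B1 * (2 * h * \<kappa>) * L2_norm_on \<Omega> (\<lambda>x. u x - u_h x)"
      by (simp add: field_simps)
    moreover have "h powr (2 + lam) = h * h powr (1 + lam)"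
    proof -
      have "h powr (2 + lam) = h powr 1 * h powr (1 + lam)"
        by (simp only: powr_add[symmetric]) simp
      then show ?thesis
        using h by simp
    qed
    \<comment> \<open>One power of \<open>h\<close> cancels: it stems from the side length of
      \<open>Q\<close> in the upper bound and lowers the exponent \<open>2 + lam\<close> to
      \<open>1 + lam\<close>.\<close>
    ultimately have "h * (\<bar>\<Lambda>\<bar> * \<bar>I0\<bar> / 2 * h powr (1 + lam)) \<le>
        h * (B1 * (2 * \<kappa>) * L2_norm_on \<Omega> (\<lambda>x. u x - u_h x))"
      by (simp add: mult_ac)
    then have "\<bar>\<Lambda>\<bar> * \<bar>I0\<bar> / 2 * h powr (1 + lam) \<le> B1 * (2 * \<kappa>) * L2_norm_on \<Omega> (\<lambda>x. u x - u_h x)"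
      using h by simp
    \<comment> \<open>The half left after absorption and the factor \<open>2 * \<kappa> * B1\<close>
      of the upper bound give the denominator \<open>4 * B1 * \<kappa>\<close>.\<close>
    then show ?thesis
      using B1(1) \<kappa> by (simp add: h_def[symmetric] field_simps)
  qed
  moreover have "\<bar>I0\<bar> / (4 * B1 * \<kappa>) > 0"
    using I0 B1(1) \<kappa> by simp
  ultimately show ?thesis
    using h1 by blast
qed

end
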